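(* Let $q\in(0,1)$ and let $G_{n,m}$ be the last passage time in a geometric environment with parameter $q^2$, where $n\ge m\ge1$ are integers. Then, for any $\ell\in\mathbb{N}$, $$\mathbb{P}(G_{n,m}\le\ell)=\mathbb{P}\big(x_{\max}^{(m)}(n-m,\ell)\le1-q^2\big).$$
   Context: Geometric last passage percolation: let $\omega_{i,j}$, $i,j\ge 1$, be i.i.d. with $\mathbb{P}(\omega_{i,j}=k)=(1-q^2)q^{2k}$, $k=0,1,2,\ldots$. The last passage time is $G_{n,m}=\max_{\pi}\sum_{(i,j)\in\pi}\omega_{i,j}$, the maximum being over all up-right lattice paths $\pi$ from $(1,1)$ to $(n,m)$. Jacobi unitary ensemble (JUE): for $k\ge1$ and $\lambda_1,\lambda_2>-1$, let $x_1,\ldots,x_k\in[0,1]$ have joint probability density proportional to $\prod_{1\le i<j\le k}(x_j-x_i)^2\prod_{j=1}^kx_j^{\lambda_1}(1-x_j)^{\lambda_2}$. Then $x_{\max}^{(k)}(\lambda_1,\lambda_2):=\max\{x_1,\ldots,x_k\}$. $\mathbb{N}=\{0,1,2,\ldots\}$. *)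

theory Defs
  imports "HOL-Probability.Probability"
begin

text \<open>Only the sites \<open>(i, j)\<close> with \<open>i, j \<ge> 1\<close> carry weights.\<close>

definition geometric_environment ::
  "'a measure \<Rightarrow> (nat \<times> nat \<Rightarrow> 'a \<Rightarrow> nat) \<Rightarrow> real \<Rightarrow> bool" where
  "geometric_environment M \<omega> q \<longleftrightarrow>
     prob_space M \<and>
     prob_space.indep_vars M (\<lambda>_. count_space UNIV) \<omega> ({1..} \<times> {1..}) \<and>
     (\<forall>i\<ge>1. \<forall>j\<ge>1. \<forall>k. \<P>(s in M. \<omega> (i, j) s = k) = (1 - q\<^sup>2) * q ^ (2 * k))"

definition up_right_step :: "nat \<times> nat \<Rightarrow> nat \<times> nat \<Rightarrow> bool" where
  "up_right_step p p' \<longleftrightarrow>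
     p' = (fst p + 1, snd p) \<or> p' = (fst p, snd p + 1)"

definition up_right_paths :: "nat \<times> nat \<Rightarrow> nat \<times> nat \<Rightarrow> (nat \<times> nat) list set" where
  "up_right_paths a b =
     {\<pi>. \<pi> \<noteq> [] \<and> hd \<pi> = a \<and> last \<pi> = b \<and> successively up_right_step \<pi>}"

definition last_passage_time :: "(nat \<times> nat \<Rightarrow> nat) \<Rightarrow> nat \<Rightarrow> nat \<Rightarrow> nat" where
  "last_passage_time w n m =
     Max ((\<lambda>\<pi>. \<Sum>p\<in>set \<pi>. w p) ` up_right_paths (1, 1) (n, m))"

text \<open>
  Since \<open>0 powr 0 = 0\<close>, this weight differs from the one with \<open>0 ^ 0 = 1\<close> when
  an exponent is \<open>0\<close>, but only on the Lebesgue null set where some coordinate is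
  an endpoint of \<open>[0, 1]\<close>.
\<close>

definition jue_weight :: "nat \<Rightarrow> real \<Rightarrow> real \<Rightarrow> (nat \<Rightarrow> real) \<Rightarrow> real" where
  "jue_weight k a b x =
     (\<Prod>j = 1..k. \<Prod>i = 1..<j. (x j - x i)\<^sup>2) *
     (\<Prod>j = 1..k. indicator {0..1} (x j) * (x j powr a * (1 - x j) powr b))"

text \<open>The constant \<open>c\<close> is determined by the total mass being \<open>1\<close>.\<close>

definition jacobi_unitary_ensemble ::
  "'b measure \<Rightarrow> (nat \<Rightarrow> 'b \<Rightarrow> real) \<Rightarrow> nat \<Rightarrow> real \<Rightarrow> real \<Rightarrow> bool" where
  "jacobi_unitary_ensemble N X k a b \<longleftrightarrow>
     k \<ge> 1 \<and> a > -1 \<and> b > -1 \<and> prob_space N \<and>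
     (\<exists>c>0. distributed N (\<Pi>\<^sub>M j\<in>{1..k}. lborel) (\<lambda>s. \<lambda>j\<in>{1..k}. X j s)
        (\<lambda>x. ennreal (c * jue_weight k a b x)))"

end

theory Submission
  imports Defs "Jordan_Normal_Form.Determinant" "HOL-Computational_Algebra.Formal_Laurent_Series"
begin

text \<open>
  Following Johansson, the joint distribution function of \<open>G n 1, ..., G n m\<close> at an increasing vector
  is a determinant of iterated differences and sums of negative binomial weights: adding a single
  site to the environment yields a recursion that both sides satisfy. At a constant vector \<open>l\<close>,
  row and column operations with explicit triangular matrices turn the entries into beta integrals
  of \<open>s ^ (n - 1 - i) * (t - s) ^ i * (1 - s) ^ (l + j)\<close> over \<open>[0, t]\<close>, where \<open>t = 1 - q\<^sup>2\<close>, and Andreief's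
  identity together with two Vandermonde determinants gives the integral of the Jacobi weight over
  \<open>[0, t] ^ m\<close>, up to a factor that does not depend on \<open>t\<close>. The case \<open>t = 1\<close>, in which the
  determinant is \<open>1\<close>, identifies this factor with the normalisation constant of the ensemble.
\<close>

text \<open>The passage time at a single site obeys no closed recursion, because its update compares
  two neighbouring passage times; hence the joint distribution. Writing the entries as coefficients
  of rational functions turns differences, sums and the addition of a geometric variable into
  multiplications, and \<open>1 / fls_X\<close> shifts the position; this is why Laurent series
  appear.

  That the final factor is free of \<open>t\<close> rests on cancellations. The row operations have
  diagonal entries \<open>t ^ i\<close>, and so has the passage from the homogeneous polynomials
  \<open>s ^ (m - 1 - i) * (t - s) ^ i\<close> to monomials in \<open>s\<close>. In each entry, the
  factor \<open>t ^ n\<close> of the weights cancels against that of the beta integral. The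
  remaining constant is fixed by normalisation, so no Selberg integral has to be evaluated. The
  assumption \<open>m \<le> n\<close> makes the exponents \<open>n - 1 - i\<close> genuine.\<close>

hide_const (open) Determinants.det Finite_Cartesian_Product.mat

section \<open>The determinant of the last passage percolation\<close>

text \<open>
  With \<open>w\<close> the negative binomial weights of \<open>n\<close> geometric variables, the coefficient at \<open>y\<close> is
  \<open>(\<Delta> ^ (j - i - 1) w) (y + 1)\<close> for the forward difference \<open>\<Delta>\<close>, where negative powers of
  \<open>\<Delta>\<close> stand for summation.
\<close>

definition lpp_entry :: "real \<Rightarrow> nat \<Rightarrow> nat \<Rightarrow> nat \<Rightarrow> real fls" where
  "lpp_entry p n i j =
     ((1 - fls_X) / fls_X) ^ j * (fls_X / (1 - fls_X)) ^ i / (1 - fls_X) *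
     (fls_const (1 - p) / (1 - fls_const p * fls_X)) ^ n"

lemma one_minus_const_fls_X_eq:
  "1 - fls_const (p :: real) * fls_X = fps_to_fls (1 - fps_const p * fps_X)"
  by (simp add: fls_times_fps_to_fls[where f = "fps_const p"])

lemma one_minus_const_fls_X_neq_0 [simp]: "1 - fls_const (p :: real) * fls_X \<noteq> 0"
proof
  assume "1 - fls_const p * fls_X = 0"
  then have "fls_nth (1 - fls_const p * fls_X) 0 = 0" by simp
  then show False by simp
qed

lemma one_minus_fls_X_neq_0 [simp]: "1 - (fls_X :: real fls) \<noteq> 0"
  using one_minus_const_fls_X_neq_0[of 1] by simp

lemma fls_nth_X_times: "fls_nth (fls_X * f) x = fls_nth (f :: real fls) (x - 1)"
  by (simp add: fls_X_times_conv_shift(1) add.commute)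

text \<open>Clearing one denominator \<open>1 - p X\<close> leaves a first-order recursion in
  \<open>x\<close>, the analytic counterpart of memorylessness in
  \<open>prob_geometric_shift\<close>.\<close>

lemma lpp_entry_time:
  "fls_nth (lpp_entry p (Suc n) i j) x =
     (1 - p) * fls_nth (lpp_entry p n i j) x + p * fls_nth (lpp_entry p (Suc n) i j) (x - 1)"
proof -
  let ?V = "1 - fls_const p * fls_X :: real fls"
  have "?V * lpp_entry p (Suc n) i j = fls_const (1 - p) * lpp_entry p n i j"
    using one_minus_const_fls_X_neq_0[of p]
    by (simp del: one_minus_const_fls_X_neq_0 add: lpp_entry_def divide_inverse mult_ac)
  then have "lpp_entry p (Suc n) i j =
      fls_const (1 - p) * lpp_entry p n i j + fls_const p * (fls_X * lpp_entry p (Suc n) i j)"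
    by (simp add: algebra_simps)
  then have "fls_nth (lpp_entry p (Suc n) i j) x =
      fls_nth (fls_const (1 - p) * lpp_entry p n i j + fls_const p * (fls_X * lpp_entry p (Suc n) i j)) x"
    by (rule arg_cong)
  then show ?thesis
    by (simp add: fls_nth_X_times)
qed

text \<open>The factor \<open>(1 - X) / X\<close> acts on coefficients as the forward difference.
  This link between neighbouring columns is what drives \<open>lpp_det_boundary\<close>.\<close>

lemma lpp_entry_space:
  "fls_nth (lpp_entry p n i (Suc j)) x =
     fls_nth (lpp_entry p n i j) (x + 1) - fls_nth (lpp_entry p n i j) x"
proof -
  have "lpp_entry p n i (Suc j) = (1 - fls_X) / fls_X * lpp_entry p n i j"
    by (simp only: lpp_entry_def power_Suc divide_inverse mult_ac)
  then have "fls_X * lpp_entry p n i (Suc j) = fls_X * ((1 - fls_X) / fls_X) * lpp_entry p n i j"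
    by (simp only: mult.assoc)
  then have "fls_X * lpp_entry p n i (Suc j) = lpp_entry p n i j - fls_X * lpp_entry p n i j"
    by (simp only: nonzero_mult_div_cancel_left[OF fls_X_nonzero] times_divide_eq_right left_diff_distrib mult_1_left)
  then have "fls_nth (fls_X * lpp_entry p n i (Suc j)) (x + 1) =
      fls_nth (lpp_entry p n i j - fls_X * lpp_entry p n i j) (x + 1)"
    by simp
  then show ?thesis by (simp add: fls_nth_X_times)
qed

lemma inverse_one_minus_const_fls_X:
  "inverse (1 - fls_const p * fls_X :: real fls) = fps_to_fls (Abs_fps (\<lambda>k. p ^ k))"
proof -
  have "(1 - fps_const p * fps_X) * Abs_fps (\<lambda>k. p ^ k) = 1"
  proof (rule fps_ext)
    fix k show "fps_nth ((1 - fps_const p * fps_X) * Abs_fps (\<lambda>k. p ^ k)) k = fps_nth 1 k"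
      by (cases k) (auto simp: left_diff_distrib mult.assoc)
  qed
  then have "(1 - fls_const p * fls_X) * fps_to_fls (Abs_fps (\<lambda>k. p ^ k)) = 1"
    by (simp only: one_minus_const_fls_X_eq flip: fls_times_fps_to_fls) simp
  then show ?thesis by (metis inverse_unique)
qed

text \<open>A pole at \<open>0\<close> can only come from the power of \<open>1 / X\<close> attached
  to \<open>j\<close>, so the column \<open>j = 0\<close> has none.\<close>

lemma lpp_entry_0_eq_fps: "\<exists>f. lpp_entry p n i 0 = fps_to_fls f"
proof -
  have "inverse (1 - fls_X :: real fls) = fps_to_fls (Abs_fps (\<lambda>k. 1))"
    using inverse_one_minus_const_fls_X[of 1] by simp
  then have "lpp_entry p n i 0 = fps_to_fls ((fps_X * Abs_fps (\<lambda>k. 1)) ^ i * Abs_fps (\<lambda>k. 1) *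
      (fps_const (1 - p) * Abs_fps (\<lambda>k. p ^ k)) ^ n)"
    unfolding lpp_entry_def divide_inverse inverse_one_minus_const_fls_X
    by (simp add: fls_times_fps_to_fls fps_to_fls_power)
  then show ?thesis by blast
qed

lemma lpp_entry_neg: "x < 0 \<Longrightarrow> fls_nth (lpp_entry p n i 0) x = 0"
  using lpp_entry_0_eq_fps[of p n i] by auto

text \<open>In both cases the geometric factor is \<open>1\<close>. The case \<open>n = 0\<close>
  starts the induction over sites; the case \<open>p = 0\<close> is \<open>t = 1\<close>, where the
  constant is read off.\<close>

lemma lpp_entry_degenerate:
  assumes "p = 0 \<or> n = 0" "x \<ge> 0"
  shows "i < j \<Longrightarrow> fls_nth (lpp_entry p n i j) x = 0"
    and "fls_nth (lpp_entry p n i i) x = 1"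
proof -
  have inv: "inverse (1 - fls_X :: real fls) = fps_to_fls (Abs_fps (\<lambda>k. 1))"
    using inverse_one_minus_const_fls_X[of 1] by simp
  have "lpp_entry p n i i = inverse (1 - fls_X)"
  proof -
    have "((1 - fls_X) / fls_X) ^ i * (fls_X / (1 - fls_X)) ^ i = (1 :: real fls)"
      unfolding power_mult_distrib[symmetric] times_divide_times_eq mult.commute[of fls_X]
      by (subst divide_self) (use one_minus_fls_X_neq_0 in auto)
    then show ?thesis using assms by (auto simp: lpp_entry_def divide_inverse)
  qed
  then have diag: "fls_nth (lpp_entry p n i i) x = 1" if "x \<ge> 0" for x
    using that by (simp add: inv)
  then show "fls_nth (lpp_entry p n i i) x = 1" using assms by simp
  \<comment> \<open>The diagonal entry is constant on \<open>x \<ge> 0\<close>, and a forward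
    difference looks only to the right, so all differences vanish there.\<close>
  have "fls_nth (lpp_entry p n i (Suc (i + d))) x = 0" if "x \<ge> 0" for d x
    using that
  proof (induction d arbitrary: x)
    case 0
    then show ?case using diag by (simp add: lpp_entry_space)
  next
    case (Suc d)
    then show ?case using lpp_entry_space[of p n i "Suc (i + d)" x] by simp
  qed
  then show "i < j \<Longrightarrow> fls_nth (lpp_entry p n i j) x = 0"
    using assms(2) less_iff_Suc_add by auto
qed

text \<open>
  The parameters \<open>n\<close> and \<open>k\<close> encode the lattice path along which \<open>k\<close> rows have reached \<open>n + 1\<close> and
  the remaining ones have reached \<open>n\<close>.
\<close>

definition lpp_det :: "real \<Rightarrow> nat \<Rightarrow> nat \<Rightarrow> nat \<Rightarrow> (nat \<Rightarrow> int) \<Rightarrow> real" where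
  "lpp_det p m n k y =
     det (mat m m (\<lambda>(i, j). fls_nth (lpp_entry p (if j < k then Suc n else n) i j) (y j)))"

section \<open>Recursion and boundary relations of the determinant\<close>

lemma lpp_det_full: "lpp_det p m n m y = lpp_det p m (Suc n) 0 y"
  unfolding lpp_det_def by (intro arg_cong[where f = det] eq_matI) auto

lemma lpp_det_neg:
  assumes "0 < m" "y 0 < 0"
  shows "lpp_det p m n k y = 0"
proof -
  let ?A = "mat m m (\<lambda>(i, j). fls_nth (lpp_entry p (if j < k then Suc n else n) i j) (y j))"
  have "det ?A = (\<Sum>i<m. ?A $$ (i, 0) * cofactor ?A i 0)"
    using assms by (intro laplace_expansion_column) auto
  also have "\<dots> = 0" using assms by (intro sum.neutral) (auto simp: lpp_entry_neg)
  finally show ?thesis by (simp add: lpp_det_def)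
qed

lemma lpp_det_degenerate:
  assumes "p = 0 \<or> n = 0" "\<And>j. j < m \<Longrightarrow> y j \<ge> 0"
  shows "lpp_det p m n 0 y = 1"
proof -
  let ?A = "mat m m (\<lambda>(i, j). fls_nth (lpp_entry p n i j) (y j))"
  have "det ?A = prod_list (diag_mat ?A)"
    using assms by (intro det_lower_triangular[of m]) (auto simp: lpp_entry_degenerate)
  also have "diag_mat ?A = replicate m 1"
    using assms by (intro nth_equalityI) (auto simp: diag_mat_def lpp_entry_degenerate)
  finally show ?thesis by (simp add: lpp_det_def)
qed

text \<open>The three matrices differ only in column \<open>k\<close>, so linearity in that column
  lifts \<open>lpp_entry_time\<close> to determinants.\<close>

lemma lpp_det_time:
  assumes "k < m"
  shows "lpp_det p m n (Suc k) y =
    p * lpp_det p m n (Suc k) (y(k := y k - 1)) + (1 - p) * lpp_det p m n k y"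
proof -
  define A where "A k y = mat m m
    (\<lambda>(i, j). fls_nth (lpp_entry p (if j < k then Suc n else n) i j) (y j))" for k y
  have exp: "det (A k' y') = (\<Sum>i<m. A k' y' $$ (i, k) * cofactor (A k' y') i k)" for k' y'
    using assms by (intro laplace_expansion_column) (auto simp: A_def)
  have cof: "cofactor (A (Suc k) (y(k := y k - 1))) i k = cofactor (A (Suc k) y) i k"
    "cofactor (A k y) i k = cofactor (A (Suc k) y) i k" if "i < m" for i
    unfolding cofactor_def mat_delete_def A_def using that assms
    by (auto intro!: arg_cong[where f = det] eq_matI)
  have "A (Suc k) y $$ (i, k) =
      p * A (Suc k) (y(k := y k - 1)) $$ (i, k) + (1 - p) * A k y $$ (i, k)" if "i < m" for i
    using that assms lpp_entry_time[of p n i k "y k"] by (simp add: A_def)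
  then have "det (A (Suc k) y) = (\<Sum>i<m.
      (p * A (Suc k) (y(k := y k - 1)) $$ (i, k) + (1 - p) * A k y $$ (i, k)) *
      cofactor (A (Suc k) y) i k)"
    unfolding exp by (intro sum.cong) auto
  also have "\<dots> = p * det (A (Suc k) (y(k := y k - 1))) + (1 - p) * det (A k y)"
    by (simp add: exp cof sum_distrib_left distrib_right sum.distrib mult.assoc)
  finally have "det (A (Suc k) y) =
      p * det (A (Suc k) (y(k := y k - 1))) + (1 - p) * det (A k y)" .
  then show ?thesis by (simp add: lpp_det_def A_def)
qed

text \<open>By \<open>lpp_entry_space\<close>, lowering \<open>y i\<close> to
  \<open>y (Suc i)\<close> subtracts column \<open>Suc i\<close> from column \<open>i\<close>. Both
  columns must have the same number of geometric factors, hence \<open>Suc i < k\<close>.\<close>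

lemma lpp_det_boundary:
  assumes "Suc i < k" "k \<le> m" "y i = y (Suc i) + 1"
  shows "lpp_det p m n k y = lpp_det p m n k (y(i := y i - 1))"
proof -
  define A where "A y = mat m m
    (\<lambda>(i, j). fls_nth (lpp_entry p (if j < k then Suc n else n) i j) (y j))" for y
  have "A y = addcol 1 i (Suc i) (A (y(i := y i - 1)))"
    using assms by (intro eq_matI) (auto simp: A_def mat_addcol_def lpp_entry_space)
  then have "det (A y) = det (A (y(i := y i - 1)))"
    using assms by (simp add: det_addcol[of "Suc i" m i] A_def)
  then show ?thesis by (simp add: lpp_det_def A_def)
qed

lemma lpp_det_cap:
  assumes "k < m" and mono: "\<And>i j. i \<le> j \<Longrightarrow> j < m \<Longrightarrow> y i \<le> y j"
  shows "lpp_det p m n (Suc k) (y(k := y k - 1)) =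
    lpp_det p m n (Suc k) (\<lambda>j. if j \<le> k then min (y j) (y k - 1) else y j)"
proof -
  \<comment> \<open>Only a run of coordinates equal to \<open>y k\<close> is affected, and each
    exceeds its right neighbour by exactly one when its turn comes. Repairing from right to left
    leads from \<open>c k\<close>, where only \<open>y k\<close> is lowered, to the increasing
    vector \<open>c 0\<close>.\<close>
  define c where "c i = (\<lambda>j. if i \<le> j \<and> j \<le> k then min (y j) (y k - 1) else y j)" for i
  have "lpp_det p m n (Suc k) (c i) = lpp_det p m n (Suc k) (c 0)" if "i \<le> k" for i
    using that
  proof (induction i)
    case (Suc i)
    have "lpp_det p m n (Suc k) (c (Suc i)) = lpp_det p m n (Suc k) (c i)"
    proof (cases "y i \<le> y k - 1")
      case True
      then have "c (Suc i) = c i"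
        unfolding c_def by (intro ext) (metis Suc_leD min.absorb1 not_less_eq_eq order_antisym)
      then show ?thesis by simp
    next
      case False
      have "y i \<le> y k" "y i \<le> y (Suc i)" "y (Suc i) \<le> y k" using mono Suc.prems assms(1) by auto
      with False have eq: "y i = y k" "y (Suc i) = y k" by auto
      have "c (Suc i) i = c (Suc i) (Suc i) + 1"
        using Suc.prems eq by (simp add: c_def)
      then have "lpp_det p m n (Suc k) (c (Suc i)) =
          lpp_det p m n (Suc k) ((c (Suc i))(i := c (Suc i) i - 1))"
        using assms(1) Suc.prems by (intro lpp_det_boundary) auto
      also have "(c (Suc i))(i := c (Suc i) i - 1) = c i"
        using Suc.prems eq by (auto simp: c_def fun_eq_iff)
      finally show ?thesis .
    qed
    with Suc show ?case by simp
  qed simp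
  from this[of k] have "lpp_det p m n (Suc k) (c k) = lpp_det p m n (Suc k) (c 0)" by simp
  moreover have "c k = y(k := y k - 1)" by (auto simp: c_def fun_eq_iff)
  ultimately show ?thesis by (simp add: c_def)
qed

section \<open>Last passage percolation\<close>

fun lpp :: "(nat \<times> nat \<Rightarrow> nat) \<Rightarrow> nat \<Rightarrow> nat \<Rightarrow> nat" where
  "lpp w 0 j = 0"
| "lpp w (Suc i) 0 = 0"
| "lpp w (Suc i) (Suc j) = max (lpp w i (Suc j)) (lpp w (Suc i) j) + w (Suc i, Suc j)"

lemma lpp_0_right [simp]: "lpp w i 0 = 0"
  by (cases i) auto

lemma lpp_mono_right: "j \<le> j' \<Longrightarrow> lpp w i j \<le> lpp w i j'"
  by (rule lift_Suc_mono_le[where f = "\<lambda>j. lpp w i j"]) (cases i; auto)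

lemma lpp_cong:
  "(\<And>a b. a \<in> {1..i} \<Longrightarrow> b \<in> {1..j} \<Longrightarrow> w (a, b) = w' (a, b)) \<Longrightarrow> lpp w i j = lpp w' i j"
  by (induction w i j rule: lpp.induct) auto

section \<open>Lattice paths and the recursive passage time\<close>

text \<open>The bound on \<open>fst p + snd p\<close> is carried along because it shows that a site
  appended to a path is new; path weights are sums over \<open>set \<pi>\<close>, which would count
  a repeated site once.\<close>

lemma up_right_path_bound:
  assumes "\<pi> \<noteq> []" "hd \<pi> = (1, 1)" "successively up_right_step \<pi>"
  shows "fst (last \<pi>) \<ge> 1 \<and> snd (last \<pi>) \<ge> 1 \<and>
    (\<forall>p\<in>set \<pi>. fst p + snd p \<le> fst (last \<pi>) + snd (last \<pi>)) \<and>
    (\<Sum>p\<in>set \<pi>. w p) \<le> lpp w (fst (last \<pi>)) (snd (last \<pi>))"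
  using assms
proof (induction \<pi> rule: rev_induct)
  case (snoc x \<pi>)
  show ?case
  proof (cases "\<pi> = []")
    case True
    with snoc.prems have "x = (1, 1)" by simp
    with True show ?thesis by simp
  next
    case False
    with snoc.prems have hd: "hd \<pi> = (1, 1)" and succ: "successively up_right_step \<pi>"
      and step: "up_right_step (last \<pi>) x"
      by (auto simp: successively_append_iff)
    obtain a b where ab: "last \<pi> = (a, b)" by force
    from snoc.IH[OF False hd succ] have IH: "a \<ge> 1" "b \<ge> 1"
      "\<forall>p\<in>set \<pi>. fst p + snd p \<le> a + b" "(\<Sum>p\<in>set \<pi>. w p) \<le> lpp w a b"
      by (auto simp: ab)
    obtain a' b' where [simp]: "a = Suc a'" "b = Suc b'"
      using IH(1,2) by (metis Suc_le_D One_nat_def)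
    have "(\<Sum>p\<in>set (\<pi> @ [x]). w p) \<le> (\<Sum>p\<in>set \<pi>. w p) + w x"
      by (cases "x \<in> set \<pi>") (auto simp: insert_absorb)
    with step IH show ?thesis
      by (fastforce simp: up_right_step_def ab)
  qed
qed simp

lemma up_right_path_attains:
  assumes "i \<ge> 1" "j \<ge> 1"
  shows "\<exists>\<pi>\<in>up_right_paths (1, 1) (i, j). (\<Sum>p\<in>set \<pi>. w p) \<ge> lpp w i j"
  using assms
proof (induction w i j rule: lpp.induct)
  case (3 w i j)
  have extend: ?case
    if "up_right_step (a, b) (Suc i, Suc j)" "\<pi> \<in> up_right_paths (1, 1) (a, b)"
      "(\<Sum>p\<in>set \<pi>. w p) \<ge> max (lpp w i (Suc j)) (lpp w (Suc i) j)" for \<pi> a b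
  proof -
    from that(2) have \<pi>: "\<pi> \<noteq> []" "hd \<pi> = (1, 1)" "successively up_right_step \<pi>" "last \<pi> = (a, b)"
      by (auto simp: up_right_paths_def)
    from up_right_path_bound[OF \<pi>(1-3)] \<pi>(4)
    have "\<forall>p\<in>set \<pi>. fst p + snd p \<le> a + b" by auto
    with that(1) have "(Suc i, Suc j) \<notin> set \<pi>"
      by (fastforce simp: up_right_step_def)
    with that(3) have "(\<Sum>p\<in>set (\<pi> @ [(Suc i, Suc j)]). w p) \<ge> lpp w (Suc i) (Suc j)"
      by simp
    moreover have "\<pi> @ [(Suc i, Suc j)] \<in> up_right_paths (1, 1) (Suc i, Suc j)"
      using \<pi> that(1) by (auto simp: up_right_paths_def successively_append_iff)
    ultimately show ?thesis by blast
  qed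
  have step: "up_right_step (i, Suc j) (Suc i, Suc j)" "up_right_step (Suc i, j) (Suc i, Suc j)"
    by (auto simp: up_right_step_def)
  \<comment> \<open>A predecessor outside the quadrant has passage time \<open>0\<close>, so unless
    both are outside, a maximal one can be chosen inside.\<close>
  consider "i = 0" "j = 0" | "i \<ge> 1" "lpp w (Suc i) j \<le> lpp w i (Suc j)"
    | "j \<ge> 1" "lpp w i (Suc j) \<le> lpp w (Suc i) j"
    by (cases i; cases j; fastforce)
  then show ?case
  proof cases
    case 1
    then have "[(1, 1)] \<in> up_right_paths (1, 1) (Suc i, Suc j)"
      by (simp add: up_right_paths_def)
    then show ?thesis
      by (rule bexI[rotated]) (simp add: 1)
  next
    case 2
    with "3.IH"(1) extend[OF step(1)] show ?thesis by auto
  next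
    case 3
    with "3.IH"(2) extend[OF step(2)] show ?thesis by auto
  qed
qed auto

lemma last_passage_time_eq_lpp:
  assumes "n \<ge> 1" "m \<ge> 1"
  shows "last_passage_time w n m = lpp w n m"
  unfolding last_passage_time_def
proof (rule Max_eqI)
  have le: "(\<Sum>p\<in>set \<pi>. w p) \<le> lpp w n m" if "\<pi> \<in> up_right_paths (1, 1) (n, m)" for \<pi>
    using up_right_path_bound[of \<pi> w] that by (auto simp: up_right_paths_def)
  then show "finite ((\<lambda>\<pi>. \<Sum>p\<in>set \<pi>. w p) ` up_right_paths (1, 1) (n, m))"
    by (auto intro: finite_subset[of _ "{..lpp w n m}"])
  show "x \<le> lpp w n m" if "x \<in> (\<lambda>\<pi>. \<Sum>p\<in>set \<pi>. w p) ` up_right_paths (1, 1) (n, m)" for x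
    using le that by auto
  show "lpp w n m \<in> (\<lambda>\<pi>. \<Sum>p\<in>set \<pi>. w p) ` up_right_paths (1, 1) (n, m)"
  proof -
    obtain \<pi> where "\<pi> \<in> up_right_paths (1, 1) (n, m)" "lpp w n m \<le> (\<Sum>p\<in>set \<pi>. w p)"
      using up_right_path_attains[OF assms] by blast
    with le show ?thesis by (metis image_eqI order_antisym)
  qed
qed

section \<open>Events determined by finitely many weights\<close>

definition depends_on :: "'i set \<Rightarrow> (('i \<Rightarrow> 'b) \<Rightarrow> bool) \<Rightarrow> bool" where
  "depends_on B Q \<longleftrightarrow> (\<forall>w w'. (\<forall>b\<in>B. w b = w' b) \<longrightarrow> Q w = Q w')"

text \<open>On a finite product of countable discrete spaces every set is measurable, so any
  predicate on finitely many coordinates is an event.\<close>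

lemma (in prob_space) events_depends_on:
  fixes X :: "'i \<Rightarrow> 'a \<Rightarrow> 'b :: countable"
  assumes "\<And>i. i \<in> B \<Longrightarrow> X i \<in> measurable M (count_space UNIV)" "finite B" "depends_on B Q"
  shows "{s \<in> space M. Q (\<lambda>i. X i s)} \<in> events"
proof -
  have "(\<lambda>s. \<lambda>i\<in>B. X i s) \<in> measurable M (Pi\<^sub>M B (\<lambda>_. count_space UNIV))"
    using assms(1) by (rule measurable_restrict)
  then have "(\<lambda>s. \<lambda>i\<in>B. X i s) \<in> measurable M (count_space (B \<rightarrow>\<^sub>E UNIV))"
    using assms(2) by (simp add: count_space_PiM_finite)
  then have "(\<lambda>s. \<lambda>i\<in>B. X i s) -` {f \<in> B \<rightarrow>\<^sub>E UNIV. Q f} \<inter> space M \<in> events"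
    by (rule measurable_sets) auto
  also have "(\<lambda>s. \<lambda>i\<in>B. X i s) -` {f \<in> B \<rightarrow>\<^sub>E UNIV. Q f} \<inter> space M = {s \<in> space M. Q (\<lambda>i. X i s)}"
    using assms(3) unfolding depends_on_def by (auto; metis (mono_tags, lifting) restrict_apply')
  finally show ?thesis .
qed

lemma (in prob_space) prob_indep_depends_on:
  fixes X :: "'i \<Rightarrow> 'a \<Rightarrow> 'b :: countable"
  assumes ind: "indep_vars (\<lambda>_. count_space UNIV) X I"
    and B: "c \<in> I" "B \<subseteq> I" "finite B" "c \<notin> B" "depends_on B Q"
  shows "prob {s \<in> space M. X c s = r \<and> Q (\<lambda>i. X i s)} =
    prob {s \<in> space M. X c s = r} * prob {s \<in> space M. Q (\<lambda>i. X i s)}"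
proof -
  let ?A = "\<lambda>s. \<lambda>i\<in>{c}. X i s" and ?B = "\<lambda>s. \<lambda>i\<in>B. X i s"
  let ?Xa = "{f \<in> {c} \<rightarrow>\<^sub>E UNIV. f c = r}" and ?Xb = "{f \<in> B \<rightarrow>\<^sub>E UNIV. Q f}"
  have "indep_var (Pi\<^sub>M {c} (\<lambda>_. count_space UNIV)) ?A (Pi\<^sub>M B (\<lambda>_. count_space UNIV)) ?B"
    using B by (intro indep_var_restrict[OF ind]) auto
  then have "indep_var (count_space ({c} \<rightarrow>\<^sub>E UNIV)) ?A (count_space (B \<rightarrow>\<^sub>E UNIV)) ?B"
    using B by (simp add: count_space_PiM_finite)
  from indep_varD[OF this, of ?Xa ?Xb]
  have "prob ((\<lambda>x. (?A x, ?B x)) -` (?Xa \<times> ?Xb) \<inter> space M) =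
      prob (?A -` ?Xa \<inter> space M) * prob (?B -` ?Xb \<inter> space M)" by auto
  moreover have Q: "Q (?B s) = Q (\<lambda>i. X i s)" for s
    using B(5) unfolding depends_on_def by (metis (mono_tags, lifting) restrict_apply')
  have "?A -` ?Xa \<inter> space M = {s \<in> space M. X c s = r}" by auto
  moreover have "?B -` ?Xb \<inter> space M = {s \<in> space M. Q (\<lambda>i. X i s)}"
    using Q by auto
  moreover have "(\<lambda>x. (?A x, ?B x)) -` (?Xa \<times> ?Xb) \<inter> space M =
      {s \<in> space M. X c s = r \<and> Q (\<lambda>i. X i s)}"
    using Q by auto
  ultimately show ?thesis by simp
qed

lemma depends_on_lpp_le:
  assumes "{1..i} \<times> {1..j} \<subseteq> B"
  shows "depends_on B (\<lambda>w. int (lpp w i j) \<le> z)"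
  unfolding depends_on_def
proof safe
  fix w w' :: "nat \<times> nat \<Rightarrow> nat" assume "\<forall>b\<in>B. w b = w' b"
  then have "lpp w i j = lpp w' i j"
    using assms by (intro lpp_cong) (meson SigmaI subsetD)
  then show "int (lpp w i j) \<le> z \<Longrightarrow> int (lpp w' i j) \<le> z"
    "int (lpp w' i j) \<le> z \<Longrightarrow> int (lpp w i j) \<le> z" by simp_all
qed

lemma depends_on_conj: "depends_on B P \<Longrightarrow> depends_on B Q \<Longrightarrow> depends_on B (\<lambda>w. P w \<and> Q w)"
  unfolding depends_on_def by metis

lemma depends_on_ball: "(\<And>x. x \<in> S \<Longrightarrow> depends_on B (P x)) \<Longrightarrow> depends_on B (\<lambda>w. \<forall>x\<in>S. P x w)"
  unfolding depends_on_def by (intro allI impI ball_cong) auto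

text \<open>It mirrors the indexing of \<open>lpp_det\<close>. The thresholds are integers because
  the recursion lowers them below \<open>0\<close>, where the event becomes empty.\<close>

definition lpp_event :: "nat \<Rightarrow> nat \<Rightarrow> nat \<Rightarrow> (nat \<Rightarrow> int) \<Rightarrow> (nat \<times> nat \<Rightarrow> nat) \<Rightarrow> bool" where
  "lpp_event m n k y w \<longleftrightarrow> (\<forall>j<m. int (lpp w (if j < k then Suc n else n) (Suc j)) \<le> y j)"

section \<open>The joint distribution function under the addition of a site\<close>

locale geometric_lpp = prob_space M for M :: "'a measure" +
  fixes \<omega> :: "nat \<times> nat \<Rightarrow> 'a \<Rightarrow> nat" and p :: real
  assumes indep: "indep_vars (\<lambda>_. count_space UNIV) \<omega> ({1..} \<times> {1..})"
    and geometric: "i \<ge> 1 \<Longrightarrow> j \<ge> 1 \<Longrightarrow> prob {s \<in> space M. \<omega> (i, j) s = k} = (1 - p) * p ^ k"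
begin

lemma events_local:
  "B \<subseteq> {1..} \<times> {1..} \<Longrightarrow> finite B \<Longrightarrow> depends_on B Q \<Longrightarrow> {s \<in> space M. Q (\<lambda>c. \<omega> c s)} \<in> events"
  using indep by (intro events_depends_on[of B]) (auto simp: indep_vars_def)

text \<open>Memorylessness of the weight at \<open>c\<close>: it is \<open>0\<close> with
  probability \<open>1 - p\<close>, and otherwise exceeds by one a variable of the same law. The
  proof compares the series over the values of the weight with its shift by one index.\<close>

lemma prob_geometric_shift:
  fixes A :: "int \<Rightarrow> (nat \<times> nat \<Rightarrow> nat) \<Rightarrow> bool"
  assumes "B \<subseteq> {1..} \<times> {1..}" "finite B" "\<And>z. depends_on B (A z)"
    and "c \<in> {1..} \<times> {1..}" "c \<notin> B"
  shows "prob {s \<in> space M. A (z - int (\<omega> c s)) (\<lambda>c. \<omega> c s)} =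
    (1 - p) * prob {s \<in> space M. A z (\<lambda>c. \<omega> c s)} +
    p * prob {s \<in> space M. A (z - 1 - int (\<omega> c s)) (\<lambda>c. \<omega> c s)}"
proof -
  define G where "G z = prob {s \<in> space M. A (z - int (\<omega> c s)) (\<lambda>c. \<omega> c s)}" for z
  define h where "h z = prob {s \<in> space M. A z (\<lambda>c. \<omega> c s)}" for z
  have "(\<lambda>r. (1 - p) * p ^ r * h (z - int r)) sums G z" for z
  proof -
    have dep: "depends_on (insert c B) (\<lambda>w. A (z - int (w c)) w)"
      "depends_on (insert c B) (\<lambda>w. w c = r \<and> A (z - int r) w)" for r
      using assms(3) unfolding depends_on_def by (metis insertI1 insertI2)+
    have "(\<lambda>r. prob {s \<in> space M. \<omega> c s = r \<and> A (z - int r) (\<lambda>c. \<omega> c s)}) sums G z"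
      unfolding G_def
      using assms events_local[OF _ _ dep(1)] events_local[OF _ _ dep(2)]
      by (intro prob_sums) auto
    moreover have "prob {s \<in> space M. \<omega> c s = r \<and> A (z - int r) (\<lambda>c. \<omega> c s)} =
        (1 - p) * p ^ r * h (z - int r)" for r
      using assms geometric[of "fst c" "snd c" r]
      by (subst prob_indep_depends_on[OF indep, of c B]) (auto simp: h_def)
    ultimately show ?thesis by simp
  qed
  note sums = this
  have "(\<lambda>r. p * ((1 - p) * p ^ r * h (z - 1 - int r))) sums (p * G (z - 1))"
    by (intro sums_mult sums)
  then have "(\<lambda>r. (1 - p) * p ^ Suc r * h (z - int (Suc r))) sums (p * G (z - 1))"
    by (simp add: algebra_simps)
  then have "(\<lambda>r. (1 - p) * p ^ r * h (z - int r)) sums (p * G (z - 1) + (1 - p) * p ^ 0 * h (z - int 0))"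
    by (subst (asm) sums_Suc_iff) (simp add: algebra_simps)
  with sums[of z] have "G z = p * G (z - 1) + (1 - p) * h z"
    using sums_unique2 by fastforce
  then show ?thesis by (simp add: G_def h_def)
qed

lemma prob_lpp_event_step:
  assumes "k < m" and mono: "\<And>i j. i \<le> j \<Longrightarrow> j < m \<Longrightarrow> y i \<le> y j"
  shows "prob {s \<in> space M. lpp_event m n (Suc k) y (\<lambda>c. \<omega> c s)} =
    p * prob {s \<in> space M. lpp_event m n (Suc k) (\<lambda>j. if j \<le> k then min (y j) (y k - 1) else y j) (\<lambda>c. \<omega> c s)} +
    (1 - p) * prob {s \<in> space M. lpp_event m n k y (\<lambda>c. \<omega> c s)}"
proof -
  define N where "N j = (if j < Suc k then Suc n else n)" for j
  \<comment> \<open>Here \<open>z\<close> is the room left for the two predecessors of the new site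
    \<open>(Suc n, Suc k)\<close> once its weight has been subtracted.\<close>
  define A where "A z w \<longleftrightarrow> (\<forall>j\<in>{..<m} - {k}. int (lpp w (N j) (Suc j)) \<le> y j) \<and>
    int (lpp w n (Suc k)) \<le> z \<and> int (lpp w (Suc n) k) \<le> z" for z w
  \<comment> \<open>All sites that \<open>A\<close> can see: columns before \<open>k\<close> reach
    row \<open>Suc n\<close>, the later ones only row \<open>n\<close>, and the new site is left
    out, so that its weight is independent of \<open>A z\<close>.\<close>
  define B where "B = {1..Suc n} \<times> {1..m} - ({Suc n} \<times> {Suc k..})"
  have sub: "{1..N j} \<times> {1..Suc j} \<subseteq> B" if "j \<in> {..<m} - {k}" for j
    using that by (auto simp: B_def N_def split: if_splits)
  have sub': "{1..n} \<times> {1..Suc k} \<subseteq> B" "{1..Suc n} \<times> {1..k} \<subseteq> B"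
    using assms(1) by (auto simp: B_def)
  have dep: "depends_on B (A z)" for z
    unfolding A_def using sub sub'
    by (intro depends_on_conj depends_on_ball depends_on_lpp_le) auto
  have shift: "lpp_event m n (Suc k) (y(k := z)) w \<longleftrightarrow> A (z - int (w (Suc n, Suc k))) w" for z w
  proof -
    have "lpp_event m n (Suc k) (y(k := z)) w \<longleftrightarrow>
        (\<forall>j\<in>{..<m} - {k}. int (lpp w (N j) (Suc j)) \<le> y j) \<and> int (lpp w (Suc n) (Suc k)) \<le> z"
      using assms(1) by (auto simp: lpp_event_def N_def)
    then show ?thesis by (auto simp: A_def)
  qed
  \<comment> \<open>The condition on the predecessor \<open>(Suc n, k)\<close> is absorbed by the
    one with threshold \<open>y (k - 1) \<le> y k\<close>; this uses that \<open>y\<close> is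
    increasing.\<close>
  have base: "A (y k) w \<longleftrightarrow> lpp_event m n k y w" for w
  proof
    assume A: "A (y k) w"
    show "lpp_event m n k y w"
      unfolding lpp_event_def
    proof safe
      fix j assume "j < m"
      show "int (lpp w (if j < k then Suc n else n) (Suc j)) \<le> y j"
      proof (cases "j = k")
        case False
        then have "N j = (if j < k then Suc n else n)" by (auto simp: N_def)
        with False A \<open>j < m\<close> show ?thesis unfolding A_def by (metis DiffI lessThan_iff singletonD)
      qed (use A in \<open>simp add: A_def\<close>)
    qed
  next
    assume E: "lpp_event m n k y w"
    have "int (lpp w (Suc n) k) \<le> y k"
    proof (cases k)
      case 0
      have "int (lpp w n (Suc 0)) \<le> y 0" using E assms(1) 0 by (auto simp: lpp_event_def)
      then show ?thesis using 0 by simp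
    next
      case (Suc k')
      then have "k' < m" "k' < k" using assms(1) by auto
      then have "int (lpp w (Suc n) (Suc k')) \<le> y k'"
        using E unfolding lpp_event_def by metis
      also have "y k' \<le> y k" using Suc assms(1) by (intro mono) auto
      finally show ?thesis using Suc by simp
    qed
    moreover have "int (lpp w (N j) (Suc j)) \<le> y j" if "j \<in> {..<m} - {k}" for j
      using E that unfolding lpp_event_def N_def
      by (metis DiffD1 DiffD2 lessThan_iff less_Suc_eq singletonI)
    moreover have "int (lpp w n (Suc k)) \<le> y k"
      using E assms(1) unfolding lpp_event_def by (metis less_irrefl)
    ultimately show "A (y k) w" by (simp add: A_def)
  qed
  \<comment> \<open>Passage times increase along a row, so the lowered threshold at \<open>k\<close>
    binds at all earlier columns too. This is the counterpart of \<open>lpp_det_cap\<close>.\<close>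
  have cap: "lpp_event m n (Suc k) (y(k := y k - 1)) w \<longleftrightarrow>
      lpp_event m n (Suc k) (\<lambda>j. if j \<le> k then min (y j) (y k - 1) else y j) w" for w
  proof
    assume E: "lpp_event m n (Suc k) (y(k := y k - 1)) w"
    have "int (lpp w (Suc n) (Suc k)) \<le> y k - 1"
      using E assms(1) by (auto simp: lpp_event_def dest!: spec[of _ k])
    moreover have "lpp w (Suc n) (Suc j) \<le> lpp w (Suc n) (Suc k)" if "j \<le> k" for j
      using that by (intro lpp_mono_right) auto
    ultimately have le: "int (lpp w (Suc n) (Suc j)) \<le> y k - 1" if "j \<le> k" for j
      using that by fastforce
    show "lpp_event m n (Suc k) (\<lambda>j. if j \<le> k then min (y j) (y k - 1) else y j) w"
      unfolding lpp_event_def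
    proof safe
      fix j assume "j < m"
      with E have "int (lpp w (if j < Suc k then Suc n else n) (Suc j)) \<le> (y(k := y k - 1)) j"
        unfolding lpp_event_def by blast
      with le[of j] show "int (lpp w (if j < Suc k then Suc n else n) (Suc j)) \<le>
          (if j \<le> k then min (y j) (y k - 1) else y j)"
        by (cases "j = k") (auto simp del: lpp.simps)
    qed
  next
    assume E: "lpp_event m n (Suc k) (\<lambda>j. if j \<le> k then min (y j) (y k - 1) else y j) w"
    show "lpp_event m n (Suc k) (y(k := y k - 1)) w"
      unfolding lpp_event_def
    proof safe
      fix j assume "j < m"
      with E have "int (lpp w (if j < Suc k then Suc n else n) (Suc j)) \<le>
          (if j \<le> k then min (y j) (y k - 1) else y j)"
        unfolding lpp_event_def by blast
      then show "int (lpp w (if j < Suc k then Suc n else n) (Suc j)) \<le> (y(k := y k - 1)) j"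
        by (cases "j = k") (auto simp del: lpp.simps split: if_splits)
    qed
  qed
  have "B \<subseteq> {1..} \<times> {1..}" "finite B" "(Suc n, Suc k) \<in> {1..} \<times> {1..}" "(Suc n, Suc k) \<notin> B"
    by (auto simp: B_def)
  note * = prob_geometric_shift[OF this(1,2) _ this(3,4), where A = A and z = "y k", OF dep]
  show ?thesis
    using * shift[of "y k"] shift[of "y k - 1"] by (simp add: base cap)
qed

text \<open>
  Probability and determinant satisfy the same recursion in \<open>y k\<close>. Its term at \<open>y k - 1\<close> may leave
  the increasing vectors, and capping brings both sides back.
\<close>

lemma prob_lpp_event_eq_lpp_det:
  assumes "0 < m" "k \<le> m" and "\<And>i j. i \<le> j \<Longrightarrow> j < m \<Longrightarrow> y i \<le> y j"
  shows "prob {s \<in> space M. lpp_event m n k y (\<lambda>c. \<omega> c s)} = lpp_det p m n k y"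
proof -
  define goal where "goal n k \<longleftrightarrow> (\<forall>y. (\<forall>i j. i \<le> j \<longrightarrow> j < m \<longrightarrow> y i \<le> y j) \<longrightarrow>
    prob {s \<in> space M. lpp_event m n k y (\<lambda>c. \<omega> c s)} = lpp_det p m n k y)" for n k
  have neg: "prob {s \<in> space M. lpp_event m n k y (\<lambda>c. \<omega> c s)} = lpp_det p m n k y"
    if "y 0 < 0" for n k y
  proof -
    have "\<not> lpp_event m n k y w" for w
      using that assms(1) by (auto simp: lpp_event_def intro!: exI[of _ 0])
    then show ?thesis using that assms(1) by (simp add: lpp_det_neg)
  qed
  have start: "goal 0 0"
    unfolding goal_def
  proof safe
    fix y :: "nat \<Rightarrow> int" assume mono: "\<forall>i j. i \<le> j \<longrightarrow> j < m \<longrightarrow> y i \<le> y j"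
    show "prob {s \<in> space M. lpp_event m 0 0 y (\<lambda>c. \<omega> c s)} = lpp_det p m 0 0 y"
    proof (cases "y 0 < 0")
      case False
      then have "y j \<ge> 0" if "j < m" for j
        using mono that by (metis bot_nat_0.extremum le_less_trans not_le)
      then show ?thesis by (simp add: lpp_event_def lpp_det_degenerate prob_space)
    qed (rule neg)
  qed
  have step: "goal n (Suc k)" if "goal n k" "k < m" for n k
    unfolding goal_def
  proof safe
    fix y :: "nat \<Rightarrow> int" assume "\<forall>i j. i \<le> j \<longrightarrow> j < m \<longrightarrow> y i \<le> y j"
    then show "prob {s \<in> space M. lpp_event m n (Suc k) y (\<lambda>c. \<omega> c s)} = lpp_det p m n (Suc k) y"
    \<comment> \<open>Both sides vanish once \<open>y 0 < 0\<close>. Otherwise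
      \<open>y k \<ge> 0\<close>, and the summand \<open>1\<close> makes the measure drop even in
      the step from \<open>y k = 0\<close> to \<open>-1\<close>.\<close>
    proof (induction "nat (y k + 1)" arbitrary: y rule: less_induct)
      case less
      show ?case
      proof (cases "y 0 < 0")
        case False
        let ?y = "\<lambda>j. if j \<le> k then min (y j) (y k - 1) else y j"
        have mono: "\<And>i j. i \<le> j \<Longrightarrow> j < m \<Longrightarrow> y i \<le> y j" using less.prems by blast
        have "y 0 \<le> y k" using mono that by auto
        with False have "nat (?y k + 1) < nat (y k + 1)" by auto
        moreover have "\<forall>i j. i \<le> j \<longrightarrow> j < m \<longrightarrow> ?y i \<le> ?y j"
        proof safe
          fix i j assume "i \<le> j" "j < m"
          with mono[of i j] show "?y i \<le> ?y j" by auto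
        qed
        ultimately have IH: "prob {s \<in> space M. lpp_event m n (Suc k) ?y (\<lambda>c. \<omega> c s)} =
            lpp_det p m n (Suc k) ?y"
          by (rule less.hyps)
        have prev: "prob {s \<in> space M. lpp_event m n k y (\<lambda>c. \<omega> c s)} = lpp_det p m n k y"
          using that(1) less.prems unfolding goal_def by blast
        have cap: "lpp_det p m n (Suc k) (y(k := y k - 1)) = lpp_det p m n (Suc k) ?y"
          using that(2) mono by (rule lpp_det_cap)
        have "prob {s \<in> space M. lpp_event m n (Suc k) y (\<lambda>c. \<omega> c s)} =
            p * lpp_det p m n (Suc k) ?y + (1 - p) * lpp_det p m n k y"
          using prob_lpp_event_step[OF that(2), where y = y and n = n, OF mono]
          unfolding IH prev by simp
        also have "\<dots> = lpp_det p m n (Suc k) y"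
          unfolding lpp_det_time[OF that(2), of p n y] cap by simp
        finally show ?thesis .
      qed (rule neg)
    qed
  qed
  have "goal n k" if "k \<le> m" for n k
    using that
  proof (induction n arbitrary: k)
    case 0
    then show ?case by (induction k) (auto intro: start step)
  next
    case (Suc n)
    have "lpp_event m n m y w = lpp_event m (Suc n) 0 y w" for y w
      by (auto simp: lpp_event_def)
    with Suc.IH[of m] have "goal (Suc n) 0"
      by (simp add: goal_def lpp_det_full)
    with Suc.prems show ?case by (induction k) (auto intro: step)
  qed
  with assms show ?thesis by (simp add: goal_def)
qed

lemma prob_lpp_le:
  assumes "0 < m"
  shows "prob {s \<in> space M. lpp (\<lambda>c. \<omega> c s) n m \<le> l} = lpp_det p m n 0 (\<lambda>_. int l)"
proof -
  have "lpp_event m n 0 (\<lambda>_. int l) w \<longleftrightarrow> lpp w n m \<le> l" for w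
  proof
    assume "lpp w n m \<le> l"
    moreover have "lpp w n (Suc j) \<le> lpp w n m" if "j < m" for j
      using that by (intro lpp_mono_right) auto
    ultimately show "lpp_event m n 0 (\<lambda>_. int l) w"
      by (fastforce simp: lpp_event_def)
  qed (use assms in \<open>auto simp: lpp_event_def dest!: spec[of _ "m - 1"]\<close>)
  then show ?thesis
    using prob_lpp_event_eq_lpp_det[OF assms, of 0 "\<lambda>_. int l" n] by simp
qed

end

section \<open>Vandermonde determinants and the identity of Andreief\<close>

lemma prod_list_diag_mat:
  "prod_list (diag_mat (mat n n f)) = (\<Prod>i<n. f (i, i))" for f :: "nat \<times> nat \<Rightarrow> 'a :: comm_monoid_mult"
  unfolding diag_mat_def
  by (simp add: atLeast0LessThan flip: prod.distinct_set_conv_list)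

lemma det_mat_upper_triangular:
  fixes f :: "nat \<times> nat \<Rightarrow> 'a :: comm_ring_1"
  assumes "\<And>i j. j < i \<Longrightarrow> i < n \<Longrightarrow> f (i, j) = 0"
  shows "det (mat n n f) = (\<Prod>i<n. f (i, i))"
  unfolding prod_list_diag_mat[of n f, symmetric]
  using assms by (intro det_upper_triangular[of _ n] upper_triangularI) auto

lemma det_mat_lower_triangular:
  fixes f :: "nat \<times> nat \<Rightarrow> 'a :: comm_ring_1"
  assumes "\<And>i j. i < j \<Longrightarrow> j < n \<Longrightarrow> f (i, j) = 0"
  shows "det (mat n n f) = (\<Prod>i<n. f (i, i))"
  unfolding prod_list_diag_mat[of n f, symmetric]
  using assms by (intro det_lower_triangular[of n]) auto

lemma det_mat_mult:
  fixes f g :: "nat \<times> nat \<Rightarrow> 'a :: comm_ring_1"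
  shows "det (mat n n (\<lambda>(i, j). \<Sum>k<n. f (i, k) * g (k, j))) = det (mat n n f) * det (mat n n g)"
proof -
  have "mat n n (\<lambda>(i, j). \<Sum>k<n. f (i, k) * g (k, j)) = mat n n f * mat n n g"
    by (intro eq_matI) (auto simp: scalar_prod_def atLeast0LessThan)
  then show ?thesis by (simp add: det_mult[of _ n])
qed

lemma det_mat_scale:
  fixes A :: "nat \<Rightarrow> nat \<Rightarrow> 'a :: comm_ring_1"
  shows "det (mat n n (\<lambda>(i, j). c i * d j * A i j)) =
    (\<Prod>i<n. c i) * (\<Prod>j<n. d j) * det (mat n n (\<lambda>(i, j). A i j))"
proof -
  have "(\<Prod>i<n. c i * d (p i) * A i (p i)) = (\<Prod>i<n. c i) * (\<Prod>j<n. d j) * (\<Prod>i<n. A i (p i))"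
    if "p permutes {0..<n}" for p
  proof -
    have "(\<Prod>i<n. d (p i)) = (\<Prod>i<n. d i)"
      using prod.permute[OF that, of d] by (simp only: atLeast0LessThan o_def)
    then show ?thesis by (simp only: prod.distrib)
  qed
  then have "(\<Sum>p | p permutes {0..<n}. signof p * (\<Prod>i<n. c i * d (p i) * A i (p i))) =
    (\<Sum>p | p permutes {0..<n}. (\<Prod>i<n. c i) * (\<Prod>j<n. d j) * (signof p * (\<Prod>i<n. A i (p i))))"
    by (intro sum.cong refl) (simp only: mem_Collect_eq mult_ac)
  also have "\<dots> = (\<Prod>i<n. c i) * (\<Prod>j<n. d j) * (\<Sum>p | p permutes {0..<n}. signof p * (\<Prod>i<n. A i (p i)))"
    by (simp add: sum_distrib_left)
  finally show ?thesis
    by (simp add: det_def atLeast0LessThan)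
qed

text \<open>The matrix factors into monomials times the coefficient matrix, which is triangular
  because of the degree bound.\<close>

lemma det_mat_poly:
  fixes a :: "nat \<Rightarrow> 'a :: comm_ring_1"
  assumes "\<And>i. i < n \<Longrightarrow> degree (P i) \<le> i"
  shows "det (mat n n (\<lambda>(k, i). poly (P i) (a k))) =
    (\<Prod>i<n. coeff (P i) i) * det (mat n n (\<lambda>(k, i). a k ^ i))"
proof -
  have "poly (P i) (a k) = (\<Sum>j<n. a k ^ j * coeff (P i) j)" if "i < n" for i k
  proof -
    have "poly (P i) (a k) = (\<Sum>j\<le>degree (P i). coeff (P i) j * a k ^ j)"
      by (rule poly_altdef)
    also have "\<dots> = (\<Sum>j<n. coeff (P i) j * a k ^ j)"
      using assms[OF that] that
      by (intro sum.mono_neutral_left) (auto simp: coeff_eq_0)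
    finally show ?thesis by (simp add: mult.commute)
  qed
  then have "det (mat n n (\<lambda>(k, i). poly (P i) (a k))) =
      det (mat n n (\<lambda>(k, i). \<Sum>j<n. (\<lambda>(k, j). a k ^ j) (k, j) * (\<lambda>(j, i). coeff (P i) j) (j, i)))"
    by (intro arg_cong[where f = det] eq_matI) auto
  also have "\<dots> = det (mat n n (\<lambda>(k, i). a k ^ i)) * det (mat n n (\<lambda>(j, i). coeff (P i) j))"
    by (rule det_mat_mult)
  also have "det (mat n n (\<lambda>(j, i). coeff (P i) j)) = (\<Prod>i<n. coeff (P i) i)"
  proof -
    have "coeff (P i) j = 0" if "i < j" "j < n" for i j
      using assms[of i] that by (intro coeff_eq_0) auto
    then show ?thesis by (subst det_mat_upper_triangular) auto
  qed
  finally show ?thesis by (simp add: mult.commute)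
qed

text \<open>In the basis of Newton polynomials the matrix becomes triangular.\<close>

lemma det_vandermonde:
  fixes a :: "nat \<Rightarrow> 'a :: idom"
  shows "det (mat n n (\<lambda>(k, i). a k ^ i)) = (\<Prod>k<n. \<Prod>i<k. a k - a i)"
proof -
  define P where "P i = (\<Prod>j<i. [:- a j, 1:])" for i
  have monic: "degree (P i) = i \<and> coeff (P i) i = 1" for i
  proof (induction i)
    case (Suc i)
    have P_Suc: "P (Suc i) = P i * [:- a i, 1:]" by (simp add: P_def)
    moreover have "P i \<noteq> 0" using Suc by auto
    ultimately have "degree (P (Suc i)) = Suc i"
      using Suc unfolding P_Suc by (subst degree_mult_eq) auto
    moreover have "lead_coeff (P (Suc i)) = 1"
      using Suc unfolding P_Suc lead_coeff_mult by simp
    ultimately show ?case by simp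
  qed (simp add: P_def)
  have ev: "poly (P i) x = (\<Prod>j<i. x - a j)" for i x
    by (simp add: P_def poly_prod)
  have "det (mat n n (\<lambda>(k, i). a k ^ i)) = det (mat n n (\<lambda>(k, i). poly (P i) (a k)))"
    using monic by (subst det_mat_poly) auto
  also have "\<dots> = (\<Prod>k<n. poly (P k) (a k))"
    by (subst det_mat_lower_triangular) (auto simp: ev)
  finally show ?thesis by (simp add: ev)
qed

text \<open>Expanding \<open>(t - a k) ^ i\<close> in powers of \<open>t\<close> expresses these
  polynomials in the monomials \<open>a k ^ (n - 1 - j)\<close> by a triangular matrix with diagonal
  \<open>t ^ i\<close>. The sign \<open>e\<close> comes from reversing the order of the monomials;
  it does not depend on \<open>a\<close> or \<open>t\<close>.\<close>

lemma det_homogeneous_basis: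
  "\<exists>e :: real. \<bar>e\<bar> = 1 \<and> (\<forall>a t. det (mat n n (\<lambda>(k, i). a k ^ (n - 1 - i) * (t - a k) ^ i)) =
     e * (\<Prod>i<n. t ^ i) * (\<Prod>k<n. \<Prod>i<k. a k - a i))"
proof -
  define rev where "rev i = (if i < n then n - 1 - i else i)" for i
  have rev: "rev permutes {0..<n}"
  proof (rule bij_imp_permutes)
    show "bij_betw rev {0..<n} {0..<n}"
      by (rule bij_betwI[where g = rev]) (auto simp: rev_def)
  qed (auto simp: rev_def)
  have "det (mat n n (\<lambda>(k, i). a k ^ (n - 1 - i) * (t - a k) ^ i)) =
      signof rev * (\<Prod>i<n. t ^ i) * (\<Prod>k<n. \<Prod>i<k. a k - a i)" for a and t :: real
  proof -
    have "a k ^ (n - 1 - i) * (t - a k) ^ i =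
        (\<Sum>j<n. a k ^ (n - 1 - j) * (real (i choose j) * t ^ j * (-1) ^ (i - j)))" if "i < n" for i k
    proof -
      have "a k ^ (n - 1 - i) * (t - a k) ^ i =
          (\<Sum>j\<le>i. a k ^ (n - 1 - i) * (real (i choose j) * t ^ j * (- a k) ^ (i - j)))"
        using binomial_ring[of t "- a k" i] by (simp add: sum_distrib_left)
      also have "\<dots> = (\<Sum>j\<le>i. a k ^ (n - 1 - j) * (real (i choose j) * t ^ j * (-1) ^ (i - j)))"
      proof (intro sum.cong refl)
        fix j assume "j \<in> {..i}"
        then have "n - 1 - j = n - 1 - i + (i - j)" using that by auto
        moreover have "(- a k) ^ (i - j) = (-1) ^ (i - j) * a k ^ (i - j)"
          by (rule power_minus)
        ultimately show "a k ^ (n - 1 - i) * (real (i choose j) * t ^ j * (- a k) ^ (i - j)) =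
            a k ^ (n - 1 - j) * (real (i choose j) * t ^ j * (-1) ^ (i - j))"
          by (simp add: power_add mult_ac)
      qed
      also have "\<dots> = (\<Sum>j<n. a k ^ (n - 1 - j) * (real (i choose j) * t ^ j * (-1) ^ (i - j)))"
        using that by (intro sum.mono_neutral_left) (auto simp: binomial_eq_0)
      finally show ?thesis .
    qed
    then have "det (mat n n (\<lambda>(k, i). a k ^ (n - 1 - i) * (t - a k) ^ i)) =
        det (mat n n (\<lambda>(k, i). \<Sum>j<n. (\<lambda>(k, j). a k ^ (n - 1 - j)) (k, j) *
          (\<lambda>(j, i). real (i choose j) * t ^ j * (-1) ^ (i - j)) (j, i)))"
      by (intro arg_cong[where f = det] eq_matI) auto
    also have "\<dots> = det (mat n n (\<lambda>(k, j). a k ^ (n - 1 - j))) *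
        det (mat n n (\<lambda>(j, i). real (i choose j) * t ^ j * (-1) ^ (i - j)))"
      by (rule det_mat_mult)
    also have "det (mat n n (\<lambda>(j, i). real (i choose j) * t ^ j * (-1) ^ (i - j))) = (\<Prod>i<n. t ^ i)"
      by (subst det_mat_upper_triangular) (auto simp: binomial_eq_0)
    also have "det (mat n n (\<lambda>(k, j). a k ^ (n - 1 - j))) =
        det (mat n n (\<lambda>(j, k). a k ^ (n - 1 - j)))"
      by (subst det_transpose[of _ n, symmetric]) (auto intro!: arg_cong[where f = det] eq_matI)
    also have "\<dots> = det (mat n n (\<lambda>(j, k). mat n n (\<lambda>(j, k). a k ^ j) $$ (rev j, k)))"
      by (intro arg_cong[where f = det] eq_matI) (auto simp: rev_def)
    also have "\<dots> = signof rev * det (mat n n (\<lambda>(j, k). a k ^ j))"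
      using rev by (intro det_permute_rows) auto
    also have "det (mat n n (\<lambda>(j, k). a k ^ j)) = det (mat n n (\<lambda>(k, j). a k ^ j))"
      by (subst det_transpose[of _ n, symmetric]) (auto intro!: arg_cong[where f = det] eq_matI)
    also have "\<dots> = (\<Prod>k<n. \<Prod>i<k. a k - a i)"
      by (rule det_vandermonde)
    finally show ?thesis by (simp add: mult_ac)
  qed
  moreover have "\<bar>signof rev :: real\<bar> = 1" by (simp add: sign_def)
  ultimately show ?thesis by blast
qed

text \<open>Expanding both determinants separates the variables. The shift \<open>Suc k\<close>
  reconciles matrix indices from \<open>0\<close> with variables indexed by
  \<open>{1..m}\<close>.\<close>

lemma andreief:
  fixes f g :: "nat \<Rightarrow> real \<Rightarrow> real"
  assumes int: "\<And>i j. i < m \<Longrightarrow> j < m \<Longrightarrow> integrable lborel (\<lambda>s. f i s * g j s)"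
  defines "F \<equiv> \<lambda>x. det (mat m m (\<lambda>(k, i). f i (x (Suc k)))) * det (mat m m (\<lambda>(k, i). g i (x (Suc k))))"
  shows "integrable (\<Pi>\<^sub>M j\<in>{1..m}. lborel) F"
    and "integral\<^sup>L (\<Pi>\<^sub>M j\<in>{1..m}. lborel) F =
      fact m * det (mat m m (\<lambda>(i, j). \<integral>s. f i s * g j s \<partial>lborel))"
proof -
  interpret product_sigma_finite "\<lambda>j :: nat. lborel :: real measure" ..
  define S where "S = {p. p permutes {0..<m}}"
  define A where "A i j = (\<integral>s. f i s * g j s \<partial>lborel)" for i j
  define h where "h p q k s = f (p (k - 1)) s * g (q (k - 1)) s" for p q :: "nat \<Rightarrow> nat" and k s
  have shift: "(\<Prod>k\<in>{0..<m}. u k) = (\<Prod>k\<in>{1..m}. u (k - 1))" for u :: "nat \<Rightarrow> real"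
    by (rule prod.reindex_bij_witness[where i = "\<lambda>k. k - 1" and j = Suc]) auto
  have F_eq: "F = (\<lambda>x. \<Sum>p\<in>S. \<Sum>q\<in>S. signof p * signof q * (\<Prod>k\<in>{1..m}. h p q k (x k)))"
  proof
    fix x
    have "F x = (\<Sum>p\<in>S. \<Sum>q\<in>S. (signof p * (\<Prod>k\<in>{0..<m}. f (p k) (x (Suc k)))) *
        (signof q * (\<Prod>k\<in>{0..<m}. g (q k) (x (Suc k)))))"
      unfolding F_def det_def by (simp add: S_def sum_product)
    also have "\<dots> = (\<Sum>p\<in>S. \<Sum>q\<in>S. signof p * signof q *
        (\<Prod>k\<in>{0..<m}. f (p k) (x (Suc k)) * g (q k) (x (Suc k))))"
      by (simp add: prod.distrib mult_ac)
    also have "\<dots> = (\<Sum>p\<in>S. \<Sum>q\<in>S. signof p * signof q * (\<Prod>k\<in>{1..m}. h p q k (x k)))"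
      unfolding shift h_def by (intro sum.cong prod.cong arg_cong2[where f = "(*)"] refl) auto
    finally show "F x = (\<Sum>p\<in>S. \<Sum>q\<in>S. signof p * signof q * (\<Prod>k\<in>{1..m}. h p q k (x k)))" .
  qed
  have perm: "p k < m" if "p \<in> S" "k < m" for p k
    using permutes_in_image[of p "{0..<m}" k] that by (auto simp: S_def)
  have int_h: "integrable lborel (h p q k)" if "p \<in> S" "q \<in> S" "k \<in> {1..m}" for p q k
    unfolding h_def using that by (intro int perm[of p] perm[of q]) auto
  have int_prod: "integrable (\<Pi>\<^sub>M j\<in>{1..m}. lborel) (\<lambda>x. \<Prod>k\<in>{1..m}. h p q k (x k))"
    if "p \<in> S" "q \<in> S" for p q
    using that int_h by (intro product_integrable_prod) auto
  then show "integrable (\<Pi>\<^sub>M j\<in>{1..m}. lborel) F"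
    unfolding F_eq by (intro Bochner_Integration.integrable_sum integrable_mult_right) auto
  have "integral\<^sup>L (\<Pi>\<^sub>M j\<in>{1..m}. lborel) F =
      (\<Sum>p\<in>S. \<Sum>q\<in>S. signof p * signof q *
        (\<integral>x. (\<Prod>k\<in>{1..m}. h p q k (x k)) \<partial>(\<Pi>\<^sub>M j\<in>{1..m}. lborel)))"
    unfolding F_eq
    by (subst Bochner_Integration.integral_sum;
        (intro Bochner_Integration.integrable_sum integrable_mult_right int_prod sum.cong refl)?; assumption?)
       (subst Bochner_Integration.integral_sum;
        (intro Bochner_Integration.integrable_sum integrable_mult_right int_prod sum.cong refl)?, auto)
  also have "\<dots> = (\<Sum>p\<in>S. \<Sum>q\<in>S. signof p * signof q * (\<Prod>k\<in>{1..m}. integral\<^sup>L lborel (h p q k)))"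
    using int_h by (intro sum.cong refl arg_cong2[where f = "(*)"] product_integral_prod) auto
  also have "\<dots> = (\<Sum>p\<in>S. \<Sum>q\<in>S. signof p * signof q * (\<Prod>k\<in>{0..<m}. A (p k) (q k)))"
    unfolding shift by (simp add: h_def[abs_def] A_def)
  \<comment> \<open>For fixed \<open>p\<close> the sum over \<open>q\<close> is the determinant with
    rows permuted by \<open>p\<close>. Its sign cancels \<open>signof p\<close>, so each of the
    \<open>fact m\<close> permutations contributes the same value.\<close>
  also have "\<dots> = (\<Sum>p\<in>S. signof p * det (mat m m (\<lambda>(k, j). mat m m (\<lambda>(i, j). A i j) $$ (p k, j))))"
  proof (intro sum.cong refl)
    fix p assume p: "p \<in> S"
    have "det (mat m m (\<lambda>(k, j). mat m m (\<lambda>(i, j). A i j) $$ (p k, j))) =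
        (\<Sum>q\<in>S. signof q * (\<Prod>k\<in>{0..<m}. A (p k) (q k)))"
      unfolding det_def using perm p by (simp add: S_def[symmetric])
    then show "(\<Sum>q\<in>S. signof p * signof q * (\<Prod>k\<in>{0..<m}. A (p k) (q k))) =
        signof p * det (mat m m (\<lambda>(k, j). mat m m (\<lambda>(i, j). A i j) $$ (p k, j)))"
      by (simp add: sum_distrib_left mult.assoc)
  qed
  also have "\<dots> = (\<Sum>p\<in>S. det (mat m m (\<lambda>(i, j). A i j)))"
  proof (intro sum.cong refl)
    fix p assume "p \<in> S"
    then have "det (mat m m (\<lambda>(k, j). mat m m (\<lambda>(i, j). A i j) $$ (p k, j))) =
        signof p * det (mat m m (\<lambda>(i, j). A i j))"
      by (intro det_permute_rows) (auto simp: S_def)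
    then show "signof p * det (mat m m (\<lambda>(k, j). mat m m (\<lambda>(i, j). A i j) $$ (p k, j))) =
        det (mat m m (\<lambda>(i, j). A i j))"
      by (simp add: sign_def)
  qed
  also have "\<dots> = fact m * det (mat m m (\<lambda>(i, j). A i j))"
    by (simp add: S_def card_permutations[of "{0..<m}" m])
  finally show "integral\<^sup>L (\<Pi>\<^sub>M j\<in>{1..m}. lborel) F =
      fact m * det (mat m m (\<lambda>(i, j). \<integral>s. f i s * g j s \<partial>lborel))"
    by (simp add: A_def)
qed

section \<open>Beta integrals\<close>

lemma integrable_power_power_Icc:
  fixes t :: real
  shows "integrable lborel (\<lambda>s. indicator {0..t} s * (s ^ b * (t - s) ^ c * (1 - s) ^ d))"
proof -
  have "set_integrable lborel {0..t} (\<lambda>s. s ^ b * (t - s) ^ c * (1 - s) ^ d)"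
    by (intro borel_integrable_atLeastAtMost' continuous_intros)
  then show ?thesis by (simp add: set_integrable_def)
qed

lemma integral_power_power_Icc:
  fixes t :: real
  assumes "t \<ge> 0"
  shows "(\<integral>s. indicator {0..t} s * (s ^ b * (t - s) ^ c) \<partial>lborel) =
    fact b * fact c / fact (b + c + 1) * t ^ (b + c + 1)"
proof (induction c arbitrary: b)
  case 0
  have "(\<integral>s. indicator {0..t} s *\<^sub>R s ^ b \<partial>lborel) = t ^ (b + 1) / (b + 1) - 0 ^ (b + 1) / (b + 1)"
    using assms DERIV_cdivide[OF DERIV_pow[of "b + 1"], where c = "real (b + 1)"]
    by (intro integral_FTC_atLeastAtMost)
       (auto intro!: continuous_intros simp flip: has_real_derivative_iff_has_vector_derivative)
  also have "\<dots> = fact b * fact 0 / fact (b + 0 + 1) * t ^ (b + 0 + 1)"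
  proof -
    have "fact (b + 0 + 1) = real (b + 1) * fact b" by simp
    then have "fact b * fact 0 / fact (b + 0 + 1) = 1 / real (b + 1)"
      by (simp only:) simp
    then show ?thesis by (simp only:) simp
  qed
  finally show ?case by simp
next
  case (Suc c)
  let ?I = "\<lambda>b c. \<integral>s. indicator {0..t} s * (s ^ b * (t - s) ^ c) \<partial>lborel"
  have int: "integrable lborel (\<lambda>s. indicator {0..t} s * (s ^ b * (t - s) ^ c))" for b c
    using integrable_power_power_Icc[of t b c 0] by simp
  \<comment> \<open>Integration by parts: the integrand is the derivative of
    \<open>s ^ Suc b * (t - s) ^ Suc c\<close>, which vanishes at both ends.\<close>
  have "(\<integral>s. indicator {0..t} s *\<^sub>R
        (real (Suc b) * (s ^ b * (t - s) ^ Suc c) - real (Suc c) * (s ^ Suc b * (t - s) ^ c)) \<partial>lborel) =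
      t ^ Suc b * (t - t) ^ Suc c - 0 ^ Suc b * (t - 0) ^ Suc c"
    using assms
    by (intro integral_FTC_atLeastAtMost)
       (auto intro!: derivative_eq_intros continuous_intros
          simp: has_real_derivative_iff_has_vector_derivative[symmetric] algebra_simps
          simp del: power_Suc)
  also have "\<dots> = 0" by simp
  also have "(\<lambda>s. indicator {0..t} s *\<^sub>R
        (real (Suc b) * (s ^ b * (t - s) ^ Suc c) - real (Suc c) * (s ^ Suc b * (t - s) ^ c))) =
      (\<lambda>s. real (Suc b) * (indicator {0..t} s * (s ^ b * (t - s) ^ Suc c)) -
        real (Suc c) * (indicator {0..t} s * (s ^ Suc b * (t - s) ^ c)))"
    by (auto simp: fun_eq_iff algebra_simps)
  finally have "real (Suc b) * ?I b (Suc c) - real (Suc c) * ?I (Suc b) c = 0"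
    using int[of b "Suc c"] int[of "Suc b" c] by simp
  then have "?I b (Suc c) = real (Suc c) * ?I (Suc b) c / real (Suc b)"
    by (simp add: field_simps del: power_Suc)
  also have "?I (Suc b) c = real (Suc b) * fact b * fact c / fact (b + Suc c + 1) * t ^ (b + Suc c + 1)"
    unfolding Suc by (simp only: fact_Suc add_Suc add_Suc_right)
  finally show ?case by (simp add: fact_Suc[of c] del: of_nat_Suc fact_Suc power_Suc)
qed

text \<open>The expansion comes from \<open>t (1 - s) = (t - s) + p s\<close>.\<close>

lemma integral_power_power_power_Icc:
  fixes p :: real
  assumes "t = 1 - p" "t > 0" "i < n"
  shows "(\<integral>s. indicator {0..t} s * (s ^ (n - 1 - i) * (t - s) ^ i * (1 - s) ^ K) \<partial>lborel) =
    fact i * fact (n - 1 - i) * fact K / fact (n + K) * (t ^ n *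
      (\<Sum>k\<le>K. real ((i + (K - k)) choose (K - k)) * real ((n - 1 - i + k) choose k) * p ^ k))"
proof -
  define b where "b = n - 1 - i"
  have n: "n = b + i + 1" using assms by (simp add: b_def)
  have pw: "(t * (1 - s)) ^ K = (\<Sum>k\<le>K. real (K choose k) * p ^ k * (s ^ k * (t - s) ^ (K - k)))" for s
  proof -
    have "t * (1 - s) = p * s + (t - s)"
      unfolding assms(1) by (simp add: algebra_simps)
    then show ?thesis by (simp add: binomial_ring power_mult_distrib mult_ac)
  qed
  have int: "integrable lborel (\<lambda>s. indicator {0..t} s * (s ^ b * (t - s) ^ c))" for b c
    using integrable_power_power_Icc[of t b c 0] by simp
  \<comment> \<open>The extra factor \<open>t ^ K\<close> makes the expansion \<open>pw\<close>
    applicable and is cancelled at the end by \<open>t > 0\<close>.\<close>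
  have "t ^ K * (\<integral>s. indicator {0..t} s * (s ^ b * (t - s) ^ i * (1 - s) ^ K) \<partial>lborel) =
      (\<integral>s. t ^ K * (indicator {0..t} s * (s ^ b * (t - s) ^ i * (1 - s) ^ K)) \<partial>lborel)"
    by simp
  also have "(\<lambda>s. t ^ K * (indicator {0..t} s * (s ^ b * (t - s) ^ i * (1 - s) ^ K))) =
      (\<lambda>s. \<Sum>k\<le>K. real (K choose k) * p ^ k * (indicator {0..t} s * (s ^ (b + k) * (t - s) ^ (i + (K - k)))))"
  proof
    fix s
    have "t ^ K * (indicator {0..t} s * (s ^ b * (t - s) ^ i * (1 - s) ^ K)) =
        indicator {0..t} s * (s ^ b * (t - s) ^ i) * (t * (1 - s)) ^ K"
      by (simp add: power_mult_distrib mult_ac)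
    also have "\<dots> = (\<Sum>k\<le>K. real (K choose k) * p ^ k * (indicator {0..t} s * (s ^ (b + k) * (t - s) ^ (i + (K - k)))))"
      unfolding pw sum_distrib_left by (intro sum.cong refl) (simp only: power_add mult_ac)
    finally show "t ^ K * (indicator {0..t} s * (s ^ b * (t - s) ^ i * (1 - s) ^ K)) = \<dots>" .
  qed
  also have "integral\<^sup>L lborel \<dots> = (\<Sum>k\<le>K. real (K choose k) * p ^ k *
      (fact (b + k) * fact (i + (K - k)) / fact (n + K) * t ^ (n + K)))"
    using int assms(2) by (simp add: integral_power_power_Icc n)
      (intro sum.cong refl, simp add: algebra_simps)
  also have "\<dots> = t ^ K * (fact i * fact b * fact K / fact (n + K) * (t ^ n *
      (\<Sum>k\<le>K. real ((i + (K - k)) choose (K - k)) * real ((b + k) choose k) * p ^ k)))"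
    unfolding sum_distrib_left
  proof (intro sum.cong refl)
    fix k assume "k \<in> {..K}"
    then have c: "real (K choose k) = fact K / (fact k * fact (K - k))"
      "real ((i + (K - k)) choose (K - k)) = fact (i + (K - k)) / (fact (K - k) * fact i)"
      "real ((b + k) choose k) = fact (b + k) / (fact k * fact b)"
      by (subst binomial_fact; simp)+
    have "x / (y * z) * p ^ k * (u * v / w * t ^ (n + K)) =
        t ^ K * (r * s * x / w * (t ^ n * (v / (z * r) * (u / (y * s)) * p ^ k)))"
      if "r \<noteq> 0" "s \<noteq> 0" for r s u v w x y z :: real
      using that by (simp add: power_add mult_ac)
    then show "real (K choose k) * p ^ k *
        (fact (b + k) * fact (i + (K - k)) / fact (n + K) * t ^ (n + K)) =
        t ^ K * (fact i * fact b * fact K / fact (n + K) *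
        (t ^ n * (real ((i + (K - k)) choose (K - k)) * real ((b + k) choose k) * p ^ k)))"
      unfolding c by (metis fact_nonzero)
  qed
  finally show ?thesis
    unfolding mult_cancel_left b_def[symmetric] using assms(2) by simp
qed

section \<open>Reduction to the Jacobi weight\<close>

text \<open>
  Since \<open>(1 - p X) / (1 - X) = 1 + (1 - p) X / (1 - X)\<close> and \<open>1 / X = 1 + (1 - X) / X\<close>, triangular row and
  column operations lead from \<open>lpp_entry\<close> to these entries, which are beta integrals.
\<close>

definition lpp_entry_reduced :: "real \<Rightarrow> nat \<Rightarrow> nat \<Rightarrow> nat \<Rightarrow> real fls" where
  "lpp_entry_reduced p n i j = (1 / fls_X) ^ j * ((1 - fls_const p * fls_X) / (1 - fls_X)) ^ i / (1 - fls_X) *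
     (fls_const (1 - p) / (1 - fls_const p * fls_X)) ^ n"

lemma fls_nth_const_times_sum:
  "fls_nth (\<Sum>k\<in>S. fls_const (c k) * f k) x = (\<Sum>k\<in>S. c k * fls_nth (f k :: real fls) x)"
  by (simp add: fls_nth_sum)

lemma one_plus_fls_power:
  fixes f :: "real fls"
  assumes "i < m"
  shows "(1 + fls_const t * f) ^ i = (\<Sum>a<m. fls_const (real (i choose a) * t ^ a) * f ^ a)"
proof -
  have "(1 + fls_const t * f) ^ i = (\<Sum>a\<le>i. of_nat (i choose a) * (fls_const t * f) ^ a)"
    using binomial_ring[of "fls_const t * f" 1 i] by (simp add: add.commute)
  also have "\<dots> = (\<Sum>a\<le>i. fls_const (real (i choose a) * t ^ a) * f ^ a)"
    by (intro sum.cong refl)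
       (simp only: power_mult_distrib fls_of_nat fls_const_power mult.assoc flip: fls_const_mult_const)
  also have "\<dots> = (\<Sum>a<m. fls_const (real (i choose a) * t ^ a) * f ^ a)"
    using assms by (intro sum.mono_neutral_left) (auto simp: binomial_eq_0)
  finally show ?thesis .
qed

lemma lpp_entry_reduced_eq_sum:
  assumes "i < m" "j < m"
  shows "fls_nth (lpp_entry_reduced p n i j) x =
    (\<Sum>a<m. real (i choose a) * (1 - p) ^ a * (\<Sum>b<m. fls_nth (lpp_entry p n a b) x * real (j choose b)))"
proof -
  let ?R = "(1 - fls_X) / fls_X :: real fls" and ?S = "fls_X / (1 - fls_X) :: real fls"
  let ?W = "(fls_const (1 - p) / (1 - fls_const p * fls_X)) ^ n / (1 - fls_X)"
  have "1 - fls_const p * fls_X = (1 - fls_X) + fls_const (1 - p) * fls_X"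
    by (simp add: algebra_simps flip: fls_minus_const)
  then have S: "(1 - fls_const p * fls_X) / (1 - fls_X) = 1 + fls_const (1 - p) * ?S"
    by (simp only: add_divide_distrib divide_self[OF one_minus_fls_X_neq_0] times_divide_eq_right)
  have R: "1 / fls_X = 1 + fls_const 1 * ?R"
    by (simp add: diff_divide_distrib)
  have "lpp_entry_reduced p n i j = (\<Sum>a<m. fls_const (real (i choose a) * (1 - p) ^ a) * ?S ^ a) *
      (\<Sum>b<m. fls_const (real (j choose b) * 1 ^ b) * ?R ^ b) * ?W"
    unfolding lpp_entry_reduced_def S R one_plus_fls_power[OF assms(1)] one_plus_fls_power[OF assms(2)]
    by (simp only: divide_inverse mult_ac)
  also have "\<dots> = (\<Sum>a<m. fls_const (real (i choose a) * (1 - p) ^ a) *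
      (\<Sum>b<m. fls_const (real (j choose b)) * lpp_entry p n a b))"
    unfolding sum_product
    unfolding sum_distrib_right sum_distrib_left lpp_entry_def
    by (intro sum.cong refl) (simp only: divide_inverse mult_ac power_one mult_1_left)
  finally show ?thesis
    by (simp only: fls_nth_const_times_sum mult.commute[of "fls_nth _ _"])
qed

text \<open>Column operations combine coefficients at one common position, which is where the
  constant vector enters. The powers of \<open>1 - p\<close> are the diagonal of the row
  operations.\<close>

lemma det_lpp_entry_reduced:
  "det (mat m m (\<lambda>(i, j). fls_nth (lpp_entry_reduced p n i j) (int l))) =
    (\<Prod>i<m. (1 - p) ^ i) * lpp_det p m n 0 (\<lambda>_. int l)"
proof -
  let ?L = "\<lambda>(i, a). real (i choose a) * (1 - p) ^ a"
  let ?A = "\<lambda>(a, b). fls_nth (lpp_entry p n a b) (int l)"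
  let ?M = "\<lambda>(b, j). real (j choose b)"
  have "det (mat m m (\<lambda>(i, j). fls_nth (lpp_entry_reduced p n i j) (int l))) =
      det (mat m m (\<lambda>(i, j). \<Sum>a<m. ?L (i, a) * (\<lambda>(i, j). \<Sum>b<m. ?A (i, b) * ?M (b, j)) (a, j)))"
    by (intro arg_cong[where f = det] eq_matI) (auto simp: lpp_entry_reduced_eq_sum)
  also have "\<dots> = det (mat m m ?L) * (det (mat m m ?A) * det (mat m m ?M))"
    unfolding det_mat_mult by (rule refl)
  also have "det (mat m m ?L) = (\<Prod>i<m. (1 - p) ^ i)"
    by (subst det_mat_lower_triangular) (auto simp: binomial_eq_0)
  also have "det (mat m m ?M) = 1"
    by (subst det_mat_upper_triangular) (auto simp: binomial_eq_0)
  also have "det (mat m m ?A) = lpp_det p m n 0 (\<lambda>_. int l)"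
    by (simp add: lpp_det_def)
  finally show ?thesis by simp
qed

section \<open>The reduced entries as beta integrals\<close>

lemma fls_nth_inverse_X_power:
  "fls_nth ((1 / fls_X) ^ j * f) x = fls_nth (f :: real fls) (x + int j)"
proof (induction j arbitrary: x)
  case (Suc j)
  have "fls_X * (1 / fls_X) = (1 :: real fls)"
    by (simp only: times_divide_eq_right mult_1_right divide_self[OF fls_X_nonzero])
  then have "fls_X * ((1 / fls_X) ^ Suc j * f) = (1 / fls_X) ^ j * f"
    by (simp only: power_Suc mult.assoc[symmetric] mult_1_left)
  then have "fls_nth (fls_X * ((1 / fls_X) ^ Suc j * f)) (x + 1) = fls_nth f (x + 1 + int j)"
    by (simp only: Suc)
  then show ?case by (simp only: fls_nth_X_times) (simp add: add_ac)
qed simp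

text \<open>The numerator \<open>(1 - p X) ^ i\<close> cancels against the \<open>n\<close>
  geometric denominators and leaves exponent \<open>n - i \<ge> 1\<close>. The sum is then the
  convolution of two negative binomial series, read at the position \<open>l + j\<close> to which
  \<open>1 / X ^ j\<close> shifts.\<close>

lemma lpp_entry_reduced_nth:
  assumes "i < n"
  shows "fls_nth (lpp_entry_reduced p n i j) (int l) = (1 - p) ^ n *
    (\<Sum>k\<le>l + j. real ((i + (l + j - k)) choose (l + j - k)) * real ((n - 1 - i + k) choose k) * p ^ k)"
proof -
  let ?U = "1 - fls_X :: real fls" and ?V = "1 - fls_const p * fls_X :: real fls"
  have inv: "inverse ((1 - fls_const c * fls_X) ^ Suc a) =
      fps_to_fls (Abs_fps (\<lambda>k. real ((a + k) choose k) * c ^ k))" for a and c :: real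
  proof -
    have "inverse ((1 - fps_const c * fps_X) ^ Suc a) =
        Abs_fps (\<lambda>k. real ((a + k) choose k) * c ^ k)"
      using one_minus_const_fps_X_neg_power'[of "Suc a" c] by simp
    moreover have "fps_nth ((1 - fps_const c * fps_X) ^ Suc a) 0 \<noteq> 0"
      by (simp only: fps_nth_power_0) simp
    ultimately have "(1 - fps_const c * fps_X) ^ Suc a *
        Abs_fps (\<lambda>k. real ((a + k) choose k) * c ^ k) = 1"
      by (metis inverse_mult_eq_1')
    then have "fps_to_fls ((1 - fps_const c * fps_X) ^ Suc a) *
        fps_to_fls (Abs_fps (\<lambda>k. real ((a + k) choose k) * c ^ k)) = 1"
      by (simp only: fps_one_to_fls flip: fls_times_fps_to_fls)
    then show ?thesis
      unfolding one_minus_const_fls_X_eq fps_to_fls_power by (rule inverse_unique)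
  qed
  have n: "n = i + Suc (n - 1 - i)" using assms by simp
  have "(?V / ?U) ^ i / ?U * (fls_const (1 - p) / ?V) ^ n =
      fls_const (1 - p) ^ n * (inverse (?U ^ Suc i) * inverse (?V ^ Suc (n - 1 - i)))"
  proof -
    have "?V ^ i * inverse (?V ^ n) = inverse (?V ^ Suc (n - 1 - i))"
    proof -
      have "x * inverse (x * y) = inverse y" if "x \<noteq> 0" for x y :: "real fls"
        using that
        by (simp only: inverse_mult_distrib mult.assoc[symmetric] right_inverse mult_1_left
            not_False_eq_True)
      moreover have "?V ^ n = ?V ^ i * ?V ^ Suc (n - 1 - i)"
        by (subst n, rule power_add)
      moreover have "?V ^ i \<noteq> 0" by (rule power_not_zero, rule one_minus_const_fls_X_neq_0)
      ultimately show ?thesis by metis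
    qed
    moreover have "(?V / ?U) ^ i / ?U * (fls_const (1 - p) / ?V) ^ n =
        fls_const (1 - p) ^ n * (inverse (?U ^ Suc i) * (?V ^ i * inverse (?V ^ n)))"
      by (simp only: divide_inverse power_mult_distrib power_inverse power_Suc
          inverse_mult_distrib mult_ac)
    ultimately show ?thesis by (simp only:)
  qed
  also have "\<dots> = fls_const ((1 - p) ^ n) * fps_to_fls (Abs_fps (\<lambda>k. real ((i + k) choose k)) *
      Abs_fps (\<lambda>k. real ((n - 1 - i + k) choose k) * p ^ k))"
    using inv[of 1 i] inv[of p "n - 1 - i"]
    by (simp add: fls_times_fps_to_fls fls_const_power del: power_Suc)
  finally have eq: "(?V / ?U) ^ i / ?U * (fls_const (1 - p) / ?V) ^ n = \<dots>" .
  have split: "lpp_entry_reduced p n i j = (1 / fls_X) ^ j * ((?V / ?U) ^ i / ?U * (fls_const (1 - p) / ?V) ^ n)"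
    by (simp only: lpp_entry_reduced_def divide_inverse mult_ac)
  have "fls_nth (lpp_entry_reduced p n i j) (int l) = fls_nth (fls_const ((1 - p) ^ n) *
      fps_to_fls (Abs_fps (\<lambda>k. real ((i + k) choose k)) *
      Abs_fps (\<lambda>k. real ((n - 1 - i + k) choose k) * p ^ k))) (int l + int j)"
    unfolding split eq by (rule fls_nth_inverse_X_power)
  also have "\<dots> =
      (1 - p) ^ n * fps_nth (Abs_fps (\<lambda>k. real ((i + k) choose k)) *
      Abs_fps (\<lambda>k. real ((n - 1 - i + k) choose k) * p ^ k)) (l + j)"
    by (simp add: nat_add_distrib)
  also have "\<dots> = (1 - p) ^ n * (\<Sum>k\<le>l + j. real ((i + (l + j - k)) choose (l + j - k)) *
      (real ((n - 1 - i + k) choose k) * p ^ k))"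
    by (subst fps_mult_nth, subst sum.atLeastAtMost_rev) (simp add: atLeast0AtMost)
  finally show ?thesis by (simp add: mult.assoc)
qed

text \<open>The prefactor is a function of \<open>i\<close> times a function of \<open>j\<close>,
  both free of \<open>t\<close>, so that \<open>det_mat_scale\<close> can pull it out of the
  determinant.\<close>

lemma lpp_entry_reduced_integral:
  assumes "t = 1 - p" "t > 0" "i < n"
  shows "fls_nth (lpp_entry_reduced p n i j) (int l) =
    1 / (fact i * fact (n - 1 - i)) * (fact (n + (l + j)) / fact (l + j)) *
    (\<integral>s. indicator {0..t} s * (s ^ (n - 1 - i) * (t - s) ^ i * (1 - s) ^ (l + j)) \<partial>lborel)"
  unfolding integral_power_power_power_Icc[OF assms] lpp_entry_reduced_nth[OF assms(3)]
  by (simp add: assms(1))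

section \<open>The determinant as an integral of the Jacobi weight\<close>

lemma det_power_one_minus:
  "det (mat m m (\<lambda>(k, i). (1 - a k) ^ i)) =
     (\<Prod>i<m. (-1) ^ i) * (\<Prod>k<m. \<Prod>i<k. a k - a i)" for a :: "nat \<Rightarrow> real"
proof -
  have deg: "degree ([:1, -1 :: real:] ^ i) = i" for i
    by (simp add: degree_power_eq)
  have coeff: "coeff ([:1, -1 :: real:] ^ i) i = (-1) ^ i" for i
    using lead_coeff_power[of "[:1, -1 :: real:]" i] by (simp add: deg)
  have "det (mat m m (\<lambda>(k, i). (1 - a k) ^ i)) =
      det (mat m m (\<lambda>(k, i). poly ([:1, -1:] ^ i) (a k)))"
    by (simp add: poly_power)
  also have "\<dots> = (\<Prod>i<m. (-1) ^ i) * det (mat m m (\<lambda>(k, i). a k ^ i))"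
    by (subst det_mat_poly) (simp_all only: deg coeff order_refl)
  finally show ?thesis by (simp only: det_vandermonde)
qed

lemma jue_weight_eq:
  "jue_weight m a b x * (\<Prod>j\<in>{1..m}. indicator {..t} (x j)) =
    (\<Prod>k<m. \<Prod>i<k. x (Suc k) - x (Suc i))\<^sup>2 *
    (\<Prod>k<m. indicator {0..1} (x (Suc k)) * (x (Suc k) powr a * (1 - x (Suc k)) powr b) *
      indicator {..t} (x (Suc k)))"
proof -
  have shift: "(\<Prod>j = 1..<Suc k. u j) = (\<Prod>i<k. u (Suc i))" for u :: "nat \<Rightarrow> real" and k
    by (rule prod.reindex_bij_witness[where i = Suc and j = "\<lambda>k. k - 1"]) auto
  then have shift': "(\<Prod>j = 1..m. u j) = (\<Prod>k<m. u (Suc k))" for u :: "nat \<Rightarrow> real"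
    by (metis atLeastLessThanSuc_atLeastAtMost)
  show ?thesis
    unfolding jue_weight_def shift' shift by (simp add: prod.distrib prod_power_distrib)
qed

lemma lpp_det_eq_jue_integral:
  assumes "1 \<le> m" "m \<le> n"
  shows "\<exists>C. \<forall>t. 0 < t \<longrightarrow> t \<le> 1 \<longrightarrow>
    integrable (\<Pi>\<^sub>M j\<in>{1..m}. lborel)
      (\<lambda>x. jue_weight m (real (n - m)) (real l) x * (\<Prod>j\<in>{1..m}. indicator {..t} (x j))) \<and>
    lpp_det (1 - t) m n 0 (\<lambda>_. int l) = C * (\<integral>x. jue_weight m (real (n - m)) (real l) x *
      (\<Prod>j\<in>{1..m}. indicator {..t} (x j)) \<partial>(\<Pi>\<^sub>M j\<in>{1..m}. lborel))"
proof -
  obtain e :: real where e: "\<bar>e\<bar> = 1" and basis: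
    "\<And>a t. det (mat m m (\<lambda>(k, i). a k ^ (m - 1 - i) * (t - a k) ^ i)) =
      e * (\<Prod>i<m. t ^ i) * (\<Prod>k<m. \<Prod>i<k. a k - a i)"
    using det_homogeneous_basis[of m] by blast
  define c d :: "nat \<Rightarrow> real" where "c i = 1 / (fact i * fact (n - 1 - i))"
    and "d j = fact (n + (l + j)) / fact (l + j)" for i j
  define sgn' :: real where "sgn' = (\<Prod>i<m. (-1) ^ i)"
  have sgn': "sgn' \<noteq> 0" by (simp add: sgn'_def)
  let ?P = "\<Pi>\<^sub>M j\<in>{1..m}. lborel :: real measure"
  define J where "J t x = jue_weight m (real (n - m)) (real l) x * (\<Prod>j\<in>{1..m}. indicator {..t} (x j))"
    for t and x :: "nat \<Rightarrow> real"
  have "integrable ?P (J t) \<and> lpp_det (1 - t) m n 0 (\<lambda>_. int l) =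
      (\<Prod>i<m. c i) * (\<Prod>j<m. d j) / fact m * e * sgn' * integral\<^sup>L ?P (J t)"
    if t: "0 < t" "t \<le> 1" for t
  proof -
    \<comment> \<open>The exponents are split so that \<open>W\<close> is the one-variable factor of
      the truncated weight, with \<open>s ^ (n - m)\<close> and \<open>(1 - s) ^ l\<close>. The
      rest, \<open>s ^ (m - 1 - i) * (t - s) ^ i\<close> and \<open>(1 - s) ^ j\<close>, feeds the
      two Vandermonde determinants.\<close>
    define W where "W s = indicator {0..1} s * (s powr real (n - m) * (1 - s) powr real l) *
      indicator {..t} s" for s :: real
    define f g where "f i s = s ^ (m - 1 - i) * (t - s) ^ i * W s" and "g j s = (1 - s) ^ j"
      for i j :: nat and s :: real
    let ?h = "\<lambda>i j s. indicator {0..t} s * (s ^ (n - 1 - i) * (t - s) ^ i * (1 - s) ^ (l + j))"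
    have [measurable]: "W \<in> borel_measurable borel" unfolding W_def by measurable
    have ae: "AE s in lborel. f i s * g j s = ?h i j s" if "i < m" for i j
    proof -
      \<comment> \<open>The endpoints are excluded because \<open>0 powr 0 = 0\<close> while
        \<open>0 ^ 0 = 1\<close>, which matters when \<open>n = m\<close> or
        \<open>l = 0\<close>.\<close>
      have pointwise: "f i s * g j s = ?h i j s" if "s \<noteq> 0" "s \<noteq> 1" for s
      proof (cases "s \<in> {0..t}")
        case True
        then have "s > 0" "1 - s > 0" "s \<le> t" using that t by auto
        then have "W s = s ^ (n - m) * (1 - s) ^ l"
          by (simp add: W_def powr_realpow)
        moreover have "s ^ (n - 1 - i) = s ^ (m - 1 - i) * s ^ (n - m)"
          using \<open>i < m\<close> assms by (simp flip: power_add)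
        ultimately show ?thesis using True by (simp add: f_def g_def power_add mult_ac)
      next
        case False
        then have "W s = 0" by (auto simp: W_def indicator_def)
        with False show ?thesis by (simp add: f_def)
      qed
      show ?thesis
        using AE_lborel_singleton[of 0] AE_lborel_singleton[of 1]
        by eventually_elim (rule pointwise)
    qed
    have meas: "(\<lambda>s. f i s * g j s) \<in> borel_measurable lborel" for i j
      unfolding f_def g_def by measurable
    have meas': "?h i j \<in> borel_measurable lborel" for i j
      by measurable
    have int: "integrable lborel (\<lambda>s. f i s * g j s)" if "i < m" for i j
      using integrable_cong_AE[OF meas meas' ae[OF that]]
        integrable_power_power_Icc[of t "n - 1 - i" i "l + j"] by simp
    have eq: "(\<integral>s. f i s * g j s \<partial>lborel) = integral\<^sup>L lborel (?h i j)" if "i < m" for i j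
      using integral_cong_AE[OF meas meas' ae[OF that]] .
    define F where "F x = det (mat m m (\<lambda>(k, i). f i (x (Suc k)))) *
      det (mat m m (\<lambda>(k, i). g i (x (Suc k))))" for x :: "nat \<Rightarrow> real"
    have F: "F x = e * sgn' * (\<Prod>i<m. t ^ i) * J t x" for x
    proof -
      have "det (mat m m (\<lambda>(k, i). f i (x (Suc k)))) =
          det (mat m m (\<lambda>(k, i). W (x (Suc k)) * 1 * (x (Suc k) ^ (m - 1 - i) * (t - x (Suc k)) ^ i)))"
        by (simp add: f_def mult.commute)
      also have "\<dots> = (\<Prod>k<m. W (x (Suc k))) *
          (e * (\<Prod>i<m. t ^ i) * (\<Prod>k<m. \<Prod>i<k. x (Suc k) - x (Suc i)))"
        unfolding det_mat_scale basis by simp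
      finally show ?thesis
        unfolding F_def g_def det_power_one_minus J_def jue_weight_eq
        by (simp add: W_def sgn'_def power2_eq_square mult_ac)
    qed
    have T: "(\<Prod>i<m. t ^ i) \<noteq> 0" using t by simp
    have intF: "integrable ?P F"
      unfolding F_def using int by (intro andreief) auto
    have "J t = (\<lambda>x. 1 / (e * sgn' * (\<Prod>i<m. t ^ i)) * F x)"
      using T e sgn' unfolding F by (auto simp: fun_eq_iff)
    then have intJ: "integrable ?P (J t)" using intF by simp
    \<comment> \<open>This product of powers of \<open>t\<close> from the row operations reappears
      below from the homogeneous basis, and the two cancel.\<close>
    have "(\<Prod>i<m. t ^ i) * lpp_det (1 - t) m n 0 (\<lambda>_. int l) =
        det (mat m m (\<lambda>(i, j). fls_nth (lpp_entry_reduced (1 - t) n i j) (int l)))"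
      using det_lpp_entry_reduced[of m "1 - t" n l] by simp
    also have "\<dots> = det (mat m m (\<lambda>(i, j). c i * d j * (\<integral>s. f i s * g j s \<partial>lborel)))"
      using assms t
      by (intro arg_cong[where f = det] eq_matI) (auto simp: eq c_def d_def lpp_entry_reduced_integral[of t])
    also have "\<dots> = (\<Prod>i<m. c i) * (\<Prod>j<m. d j) *
        det (mat m m (\<lambda>(i, j). \<integral>s. f i s * g j s \<partial>lborel))"
      by (rule det_mat_scale)
    also have "det (mat m m (\<lambda>(i, j). \<integral>s. f i s * g j s \<partial>lborel)) = integral\<^sup>L ?P F / fact m"
      unfolding F_def using int by (subst andreief) auto
    also have "integral\<^sup>L ?P F = e * sgn' * (\<Prod>i<m. t ^ i) * integral\<^sup>L ?P (J t)"
      unfolding F by simp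
    finally have "(\<Prod>i<m. t ^ i) * lpp_det (1 - t) m n 0 (\<lambda>_. int l) =
        (\<Prod>i<m. t ^ i) * ((\<Prod>i<m. c i) * (\<Prod>j<m. d j) / fact m * e * sgn' * integral\<^sup>L ?P (J t))"
      by (simp add: mult_ac)
    with T intJ show ?thesis by (metis mult_left_cancel)
  qed
  then show ?thesis unfolding J_def[abs_def] by blast
qed

section \<open>Normalisation and conclusion\<close>

lemma jue_weight_nonneg: "jue_weight m a b x \<ge> 0"
  unfolding jue_weight_def by (auto intro!: mult_nonneg_nonneg prod_nonneg)

theorem theorem2p5:
  fixes q :: real and n m l :: nat
    and M :: "'a measure" and \<omega> :: "nat \<times> nat \<Rightarrow> 'a \<Rightarrow> nat"
    and N :: "'b measure" and X :: "nat \<Rightarrow> 'b \<Rightarrow> real"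
  assumes "0 < q" and "q < 1"
    and "1 \<le> m" and "m \<le> n"
    and "geometric_environment M \<omega> q"
    and "jacobi_unitary_ensemble N X m (real (n - m)) (real l)"
  shows "\<P>(s in M. last_passage_time (\<lambda>p. \<omega> p s) n m \<le> l) =
         \<P>(s in N. Max ((\<lambda>j. X j s) ` {1..m}) \<le> 1 - q\<^sup>2)"
proof -
  let ?P = "\<Pi>\<^sub>M j\<in>{1..m}. lborel :: real measure"
  let ?w = "jue_weight m (real (n - m)) (real l)"
  define H where "H t = (\<integral>x. ?w x * (\<Prod>j\<in>{1..m}. indicator {..t} (x j)) \<partial>?P)" for t
  obtain C where int: "\<And>t. 0 < t \<Longrightarrow> t \<le> 1 \<Longrightarrow>
      integrable ?P (\<lambda>x. ?w x * (\<Prod>j\<in>{1..m}. indicator {..t} (x j)))"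
    and det: "\<And>t. 0 < t \<Longrightarrow> t \<le> 1 \<Longrightarrow> lpp_det (1 - t) m n 0 (\<lambda>_. int l) = C * H t"
    using lpp_det_eq_jue_integral[OF assms(3,4), of l] unfolding H_def by blast
  from assms(6) obtain c where c: "c > 0" and N: "prob_space N"
    and dist: "distributed N ?P (\<lambda>s. \<lambda>j\<in>{1..m}. X j s) (\<lambda>x. ennreal (c * ?w x))"
    unfolding jacobi_unitary_ensemble_def by blast
  interpret N: prob_space N by (rule N)
  \<comment> \<open>Used twice: for the whole space at \<open>t = 1\<close>, which gives the total
    mass, and for the truncated region at \<open>t = 1 - q\<^sup>2\<close>.\<close>
  have prob: "measure N ((\<lambda>s. \<lambda>j\<in>{1..m}. X j s) -` A \<inter> space N) = c * H t"
    if "0 < t" "t \<le> 1" and A: "A \<in> sets ?P"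
      "\<And>x. x \<in> space ?P \<Longrightarrow> ?w x * indicator A x = ?w x * (\<Prod>j\<in>{1..m}. indicator {..t} (x j))"
    for A t
  proof -
    have "emeasure N ((\<lambda>s. \<lambda>j\<in>{1..m}. X j s) -` A \<inter> space N) =
        (\<integral>\<^sup>+ x. ennreal (c * ?w x) * indicator A x \<partial>?P)"
      by (rule distributed_emeasure[OF dist A(1)])
    also have "\<dots> = (\<integral>\<^sup>+ x. ennreal (c * (?w x * (\<Prod>j\<in>{1..m}. indicator {..t} (x j)))) \<partial>?P)"
    proof (rule nn_integral_cong)
      fix x assume "x \<in> space ?P"
      then have eq: "?w x * indicator A x = ?w x * (\<Prod>j\<in>{1..m}. indicator {..t} (x j))"
        by (rule A(2))
      show "ennreal (c * ?w x) * indicator A x =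
          ennreal (c * (?w x * (\<Prod>j\<in>{1..m}. indicator {..t} (x j))))"
        unfolding eq[symmetric] by (cases "x \<in> A") simp_all
    qed
    also have "\<dots> = ennreal (c * H t)"
      unfolding H_def using int[OF that(1,2)] c
      by (subst nn_integral_eq_integral)
         (auto intro!: mult_nonneg_nonneg jue_weight_nonneg prod_nonneg)
    finally have "emeasure N ((\<lambda>s. \<lambda>j\<in>{1..m}. X j s) -` A \<inter> space N) = ennreal (c * H t)" .
    moreover have "H t \<ge> 0"
      unfolding H_def by (intro Bochner_Integration.integral_nonneg mult_nonneg_nonneg jue_weight_nonneg prod_nonneg) auto
    ultimately show ?thesis using c by (simp add: N.emeasure_eq_measure)
  qed
  have "?w x = ?w x * (\<Prod>j\<in>{1..m}. indicator {..1} (x j))" for x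
    unfolding jue_weight_def mult.assoc prod.distrib[symmetric]
    by (rule prod.cong[OF refl]) (auto simp: indicator_def)
  then have "measure N ((\<lambda>s. \<lambda>j\<in>{1..m}. X j s) -` space ?P \<inter> space N) = c * H 1"
    by (intro prob) auto
  moreover have "(\<lambda>s. \<lambda>j\<in>{1..m}. X j s) -` space ?P \<inter> space N = space N"
    by (auto simp: space_PiM)
  ultimately have "c * H 1 = 1" by (simp add: N.prob_space)
  txt \<open>The constant \<open>C\<close> does not depend on \<open>t\<close>, so it can be read off at \<open>t = 1\<close>.\<close>
  moreover have "C * H 1 = 1"
    using det[of 1] by (simp add: lpp_det_degenerate)
  ultimately have "C = c" by (metis mult_right_cancel mult_zero_right zero_neq_one)

  interpret geometric_lpp M \<omega> "q\<^sup>2"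
    using assms(5) unfolding geometric_environment_def geometric_lpp_def geometric_lpp_axioms_def
    by (auto simp: power_mult)
  have "q\<^sup>2 < 1" using assms(1,2) by (simp add: power_less_one_iff)
  then have t: "0 < 1 - q\<^sup>2" "1 - q\<^sup>2 \<le> 1" by auto
  have "\<P>(s in M. last_passage_time (\<lambda>p. \<omega> p s) n m \<le> l) = lpp_det (q\<^sup>2) m n 0 (\<lambda>_. int l)"
    using assms(3,4) by (simp add: last_passage_time_eq_lpp prob_lpp_le)
  also have "\<dots> = c * H (1 - q\<^sup>2)"
    using det[OF t] \<open>C = c\<close> by simp
  also have "\<dots> = measure N ((\<lambda>s. \<lambda>j\<in>{1..m}. X j s) -`
      {x \<in> space ?P. \<forall>j\<in>{1..m}. x j \<le> 1 - q\<^sup>2} \<inter> space N)"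
    using t
    by (intro prob[symmetric])
       (auto simp: indicator_def prod_eq_1_iff intro!: prod.neutral)
  also have "(\<lambda>s. \<lambda>j\<in>{1..m}. X j s) -`
      {x \<in> space ?P. \<forall>j\<in>{1..m}. x j \<le> 1 - q\<^sup>2} \<inter> space N =
      {s \<in> space N. Max ((\<lambda>j. X j s) ` {1..m}) \<le> 1 - q\<^sup>2}"
    using assms(3) by (auto simp: space_PiM)
  finally show ?thesis .
qed

end
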